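(* Let $\mathcal{M}$ be a von Neumann algebra with a faithful normal tracial state $\tau$, regarded as a von Neumann algebra on $L^2(\mathcal{M},\tau)$. Then $$d_{MT}(P,Q)=d_{MT}\big(P,\overline{Q}^{S.O.T.}\big)=d_{MT}\big(\overline{P}^{S.O.T.},\overline{Q}^{S.O.T.}\big)=d_{MT}(P'',Q'')$$ for all $*$-subalgebras $P,Q$ of $\mathcal{M}$ containing $1_{\mathcal{M}}$.
   Context: $\|x\|_\tau=\tau(x^*x)^{1/2}$ on $\mathcal{M}$; $L^2(\mathcal{M},\tau)$ is the Hilbert space completion of $\mathcal{M}$ with respect to $\langle x,y\rangle_\tau=\tau(y^*x)$, on which $\mathcal{M}$ acts by left multiplication. S.O.T. is the strong operator topology and commutants are taken in $B(L^2(\mathcal{M},\tau))$. For a subalgebra $P$ of $\mathcal{M}$, $B_1(P)$ is its closed unit ball with respect to the operator norm. The Mashood-Taylor distance between subalgebras $P,Q$ of $\mathcal{M}$ is the Hausdorff distance with respect to $\|\cdot\|_\tau$ between $B_1(P)$ and $B_1(Q)$: $d_{MT}(P,Q)=\max\{\sup_{x\in B_1(P)}\inf_{y\in B_1(Q)}\|x-y\|_\tau,\ \sup_{y\in B_1(Q)}\inf_{x\in B_1(P)}\|x-y\|_\tau\}$. *)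

theory Defs
  imports "HOL-Analysis.Analysis"
begin

class scaleC =
  fixes scaleC :: "complex \<Rightarrow> 'a \<Rightarrow> 'a"  (infixr \<open>*\<^sub>C\<close> 75)

text \<open>Complex Hilbert spaces; the inner product is linear in the first argument.\<close>

class complex_hilbert = banach + scaleC +
  fixes cinner :: "'a \<Rightarrow> 'a \<Rightarrow> complex"
  assumes scaleC_add_right: "c *\<^sub>C (x + y) = c *\<^sub>C x + c *\<^sub>C y"
    and scaleC_add_left: "(c + d) *\<^sub>C x = c *\<^sub>C x + d *\<^sub>C x"
    and scaleC_scaleC: "c *\<^sub>C d *\<^sub>C x = (c * d) *\<^sub>C x"
    and scaleR_scaleC: "r *\<^sub>R x = complex_of_real r *\<^sub>C x"
    and cinner_commute: "cinner x y = cnj (cinner y x)"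
    and cinner_add_left: "cinner (x + y) z = cinner x z + cinner y z"
    and cinner_scaleC_left: "cinner (c *\<^sub>C x) y = c * cinner x y"
    and cinner_ge_zero: "0 \<le> Re (cinner x x)"
    and norm_eq_sqrt_cinner: "norm x = sqrt (Re (cinner x x))"

instantiation complex :: complex_hilbert
begin
definition scaleC_complex :: "complex \<Rightarrow> complex \<Rightarrow> complex"
  where "scaleC_complex c x = c * x"
definition cinner_complex :: "complex \<Rightarrow> complex \<Rightarrow> complex"
  where "cinner_complex x y = x * cnj y"
instance
  by standard
    (auto simp: scaleC_complex_def cinner_complex_def algebra_simps scaleR_conv_of_real cmod_def
      power2_eq_square)
end

lemma norm_scaleC: "norm (c *\<^sub>C x) = cmod c * norm (x :: 'a::complex_hilbert)"
proof -
  have "cinner (c *\<^sub>C x) (c *\<^sub>C x) = c * cnj (c * cinner x x)"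
    by (metis cinner_commute cinner_scaleC_left)
  also have "\<dots> = (c * cnj c) * cinner x x"
    by (simp add: cinner_commute[of x x, symmetric])
  also have "\<dots> = complex_of_real ((cmod c)\<^sup>2) * cinner x x"
    by (simp only: complex_norm_square)
  finally have "Re (cinner (c *\<^sub>C x) (c *\<^sub>C x)) = (cmod c)\<^sup>2 * Re (cinner x x)"
    by simp
  then show ?thesis
    by (simp add: norm_eq_sqrt_cinner[where 'a = 'a] real_sqrt_mult)
qed

lemma bounded_linear_scaleC: "bounded_linear (\<lambda>x :: 'a::complex_hilbert. c *\<^sub>C x)"
  by (rule bounded_linear_intro[where K = "cmod c"])
    (simp_all add: scaleC_add_right scaleR_scaleC scaleC_scaleC norm_scaleC mult.commute)

instantiation blinfun :: (real_normed_vector, complex_hilbert) scaleC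
begin
definition scaleC_blinfun :: "complex \<Rightarrow> ('a \<Rightarrow>\<^sub>L 'b) \<Rightarrow> ('a \<Rightarrow>\<^sub>L 'b)"
  where "scaleC_blinfun c T = Blinfun (\<lambda>x. c *\<^sub>C T x)"
instance ..
end

lemma scaleC_blinfun_apply: "blinfun_apply (c *\<^sub>C T) x = c *\<^sub>C blinfun_apply T x"
  unfolding scaleC_blinfun_def
  by (subst bounded_linear_Blinfun_apply)
    (rule bounded_linear_compose[OF bounded_linear_scaleC blinfun.bounded_linear_right], rule refl)

text \<open>Elements of the type \<^typ>\<open>'a \<Rightarrow>\<^sub>L 'a\<close> are only real-linear; the algebra of bounded operators
  on the Hilbert space is the following subset.\<close>

definition bounded_ops :: "('h::complex_hilbert \<Rightarrow>\<^sub>L 'h) set"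
  where "bounded_ops = {T. \<forall>c x. blinfun_apply T (c *\<^sub>C x) = c *\<^sub>C blinfun_apply T x}"

definition hadjoint :: "('h::complex_hilbert \<Rightarrow>\<^sub>L 'h) \<Rightarrow> ('h \<Rightarrow>\<^sub>L 'h)"
  where "hadjoint T = (THE S. \<forall>x y. cinner (blinfun_apply T x) y = cinner x (blinfun_apply S y))"

definition star_subalgebra :: "('h::complex_hilbert \<Rightarrow>\<^sub>L 'h) set \<Rightarrow> bool"
  where "star_subalgebra A \<longleftrightarrow>
    A \<subseteq> bounded_ops \<and> 0 \<in> A \<and>
    (\<forall>x\<in>A. \<forall>y\<in>A. x + y \<in> A) \<and>
    (\<forall>c. \<forall>x\<in>A. c *\<^sub>C x \<in> A) \<and>
    (\<forall>x\<in>A. \<forall>y\<in>A. x o\<^sub>L y \<in> A) \<and>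
    (\<forall>x\<in>A. hadjoint x \<in> A)"

definition commutant :: "('h::complex_hilbert \<Rightarrow>\<^sub>L 'h) set \<Rightarrow> ('h \<Rightarrow>\<^sub>L 'h) set"
  where "commutant A = {T \<in> bounded_ops. \<forall>x\<in>A. T o\<^sub>L x = x o\<^sub>L T}"

definition von_neumann_algebra :: "('h::complex_hilbert \<Rightarrow>\<^sub>L 'h) set \<Rightarrow> bool"
  where "von_neumann_algebra M \<longleftrightarrow> star_subalgebra M \<and> commutant (commutant M) = M"

definition ultraweak_topology :: "('h::complex_hilbert \<Rightarrow>\<^sub>L 'h) topology"
  where "ultraweak_topology = topology_generated_by
    {{T. (\<Sum>n. cinner (blinfun_apply T (\<xi> n)) (\<eta> n)) \<in> U} | (\<xi> :: nat \<Rightarrow> 'h) (\<eta> :: nat \<Rightarrow> 'h) U.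
      summable (\<lambda>n. (norm (\<xi> n))\<^sup>2) \<and> summable (\<lambda>n. (norm (\<eta> n))\<^sup>2) \<and> open U}"

text \<open>Functionals on \<open>M\<close> are total functions whose values outside \<open>M\<close> are irrelevant.\<close>

definition state_on :: "('h::complex_hilbert \<Rightarrow>\<^sub>L 'h) set \<Rightarrow> (('h \<Rightarrow>\<^sub>L 'h) \<Rightarrow> complex) \<Rightarrow> bool"
  where "state_on M \<tau> \<longleftrightarrow>
    (\<forall>x\<in>M. \<forall>y\<in>M. \<tau> (x + y) = \<tau> x + \<tau> y) \<and>
    (\<forall>c. \<forall>x\<in>M. \<tau> (c *\<^sub>C x) = c * \<tau> x) \<and>
    (\<forall>x\<in>M. \<tau> (hadjoint x o\<^sub>L x) \<in> \<real>\<^sub>\<ge>\<^sub>0) \<and>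
    \<tau> id_blinfun = 1"

definition tracial_on :: "('h::complex_hilbert \<Rightarrow>\<^sub>L 'h) set \<Rightarrow> (('h \<Rightarrow>\<^sub>L 'h) \<Rightarrow> complex) \<Rightarrow> bool"
  where "tracial_on M \<tau> \<longleftrightarrow> (\<forall>x\<in>M. \<forall>y\<in>M. \<tau> (x o\<^sub>L y) = \<tau> (y o\<^sub>L x))"

definition faithful_on :: "('h::complex_hilbert \<Rightarrow>\<^sub>L 'h) set \<Rightarrow> (('h \<Rightarrow>\<^sub>L 'h) \<Rightarrow> complex) \<Rightarrow> bool"
  where "faithful_on M \<tau> \<longleftrightarrow> (\<forall>x\<in>M. \<tau> (hadjoint x o\<^sub>L x) = 0 \<longrightarrow> x = 0)"

definition normal_on :: "('h::complex_hilbert \<Rightarrow>\<^sub>L 'h) set \<Rightarrow> (('h \<Rightarrow>\<^sub>L 'h) \<Rightarrow> complex) \<Rightarrow> bool"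
  where "normal_on M \<tau> \<longleftrightarrow> continuous_map (subtopology ultraweak_topology M) euclidean \<tau>"

text \<open>\<open>'h\<close> together with the canonical map \<open>\<Lambda>\<close> from \<open>M\<close> to \<open>'h\<close> is the Hilbert space completion
  of \<open>M\<close> with respect to the inner product \<open>\<tau> (y\<^sup>* x)\<close>. Completeness is part of the class of
  \<open>'h\<close>; these conditions determine the completion up to a unique unitary.\<close>

definition is_L2 :: "('k::complex_hilbert \<Rightarrow>\<^sub>L 'k) set \<Rightarrow> (('k \<Rightarrow>\<^sub>L 'k) \<Rightarrow> complex) \<Rightarrow>
    (('k \<Rightarrow>\<^sub>L 'k) \<Rightarrow> 'h::complex_hilbert) \<Rightarrow> bool"
  where "is_L2 M \<tau> \<Lambda> \<longleftrightarrow>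
    (\<forall>x\<in>M. \<forall>y\<in>M. \<Lambda> (x + y) = \<Lambda> x + \<Lambda> y) \<and>
    (\<forall>c. \<forall>x\<in>M. \<Lambda> (c *\<^sub>C x) = c *\<^sub>C \<Lambda> x) \<and>
    (\<forall>x\<in>M. \<forall>y\<in>M. cinner (\<Lambda> x) (\<Lambda> y) = \<tau> (hadjoint y o\<^sub>L x)) \<and>
    closure (\<Lambda> ` M) = UNIV"

definition left_mult :: "('k::complex_hilbert \<Rightarrow>\<^sub>L 'k) set \<Rightarrow>
    (('k \<Rightarrow>\<^sub>L 'k) \<Rightarrow> 'h::complex_hilbert) \<Rightarrow> ('k \<Rightarrow>\<^sub>L 'k) \<Rightarrow> ('h \<Rightarrow>\<^sub>L 'h)"
  where "left_mult M \<Lambda> x = (THE T. \<forall>y\<in>M. blinfun_apply T (\<Lambda> y) = \<Lambda> (x o\<^sub>L y))"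

text \<open>The trace transported to the image of \<open>M\<close> under left multiplication; it is only meaningful
  on that image.\<close>

definition L2_trace :: "('k::complex_hilbert \<Rightarrow>\<^sub>L 'k) set \<Rightarrow> (('k \<Rightarrow>\<^sub>L 'k) \<Rightarrow> complex) \<Rightarrow>
    (('k \<Rightarrow>\<^sub>L 'k) \<Rightarrow> 'h::complex_hilbert) \<Rightarrow> ('h \<Rightarrow>\<^sub>L 'h) \<Rightarrow> complex"
  where "L2_trace M \<tau> \<Lambda> T = \<tau> (inv_into M (left_mult M \<Lambda>) T)"

definition tau_norm :: "(('h::complex_hilbert \<Rightarrow>\<^sub>L 'h) \<Rightarrow> complex) \<Rightarrow> ('h \<Rightarrow>\<^sub>L 'h) \<Rightarrow> real"
  where "tau_norm \<tau> x = sqrt (Re (\<tau> (hadjoint x o\<^sub>L x)))"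

definition unit_ball :: "('h::complex_hilbert \<Rightarrow>\<^sub>L 'h) set \<Rightarrow> ('h \<Rightarrow>\<^sub>L 'h) set"
  where "unit_ball P = {x \<in> P. norm x \<le> 1}"

definition MT_dist :: "(('h::complex_hilbert \<Rightarrow>\<^sub>L 'h) \<Rightarrow> complex) \<Rightarrow>
    ('h \<Rightarrow>\<^sub>L 'h) set \<Rightarrow> ('h \<Rightarrow>\<^sub>L 'h) set \<Rightarrow> real"
  where "MT_dist \<tau> P Q = max
    (SUP x\<in>unit_ball P. INF y\<in>unit_ball Q. tau_norm \<tau> (x - y))
    (SUP y\<in>unit_ball Q. INF x\<in>unit_ball P. tau_norm \<tau> (x - y))"

abbreviation sot_closure :: "('h::complex_hilbert \<Rightarrow>\<^sub>L 'h) set \<Rightarrow> ('h \<Rightarrow>\<^sub>L 'h) set"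
  where "sot_closure P \<equiv> strong_operator_topology closure_of P"

end

theory Submission
  imports Defs
begin

text \<open>Let \<open>\<Omega>\<close> be the image of \<open>1\<close> in the \<open>L\<^sup>2\<close>-space, so that the trace norm of \<open>x\<close> is the norm
  of \<open>x \<Omega>\<close>. All four distances depend only on the closures of the orbits of \<open>\<Omega>\<close> under the unit
  balls, so it suffices that the unit ball of \<open>P\<close> is dense in the unit ball of \<open>P''\<close> for the trace
  norm; the strong closure lies in between.

  For a trace vector this form of Kaplansky's theorem is elementary. The map
  \<open>h y = 2 y (1 + y\<^sup>* y)\<^sup>-\<^sup>1\<close> takes values in the unit ball, is Lipschitz for the trace norm, and every
  strict contraction \<open>x\<close> of \<open>P''\<close> is \<open>h z\<close>, where \<open>z\<close> solves \<open>z = x (1 + z\<^sup>* z) / 2\<close>. As \<open>z \<Omega>\<close> is a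
  limit of vectors \<open>y \<Omega>\<close> with \<open>y\<close> in \<open>P\<close>, the contractions \<open>h y\<close> approximate \<open>x\<close>.

  The trace is only meaningful on the image of \<open>M\<close>, so one also needs that \<open>P''\<close> stays inside that
  image. Lifting the approximants \<open>h y\<close> to contractions of \<open>M\<close>, normality of the trace shows that a
  weak cluster point of the lifts is a preimage of \<open>x\<close>.\<close>

section \<open>Complex Hilbert spaces\<close>

text \<open>The usual density argument treats self-adjoint contractions by functional calculus and
  reaches the general case through 2x2 matrices. Here the scalar function
  \<open>2 t / (1 + t^2)\<close> is given a form valid for arbitrary \<open>y\<close>, and every
  inverse, square root and preimage comes from Banach's fixed point theorem, so norm completeness
  replaces spectral theory. This is why contractions are first made strict and the strictness is
  removed by scaling, and why transforms of elements of \<open>P\<close> land only in the norm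
  closure of \<open>P\<close> and have to be approximated once more. There is a circularity to
  avoid: the trace estimate must be applied to elements of \<open>P''\<close> before they are known
  to lie in the image of \<open>M\<close>, where the trace makes sense. The estimate is therefore
  phrased through the property \<open>norm (s^* \<Omega>) = norm (s \<Omega>)\<close>, which is
  meaningful for every bounded operator and is proved on the bicommutant of the image of
  \<open>M\<close>.\<close>

context complex_hilbert
begin

lemma scaleC_one [simp]: "1 *\<^sub>C x = x"
  by (metis of_real_1 scaleR_one scaleR_scaleC)

lemma cinner_add_right: "cinner x (y + z) = cinner x y + cinner x z"
  by (metis cinner_add_left cinner_commute complex_cnj_add)

lemma cinner_scaleC_right: "cinner x (c *\<^sub>C y) = cnj c * cinner x y"
  by (metis cinner_commute cinner_scaleC_left complex_cnj_mult)

lemma cinner_self: "cinner x x = of_real ((norm x)\<^sup>2)"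
proof -
  have "Im (cinner x x) = 0"
    using cinner_commute[of x x] by (simp add: complex_eq_iff)
  then show ?thesis
    using cinner_ge_zero[of x] by (simp add: complex_eq_iff norm_eq_sqrt_cinner)
qed

end

lemma scaleC_zero_left [simp]: "0 *\<^sub>C x = (0 :: 'a::complex_hilbert)"
  using scaleR_scaleC[of 0 x] by simp

lemma scaleC_minus_one [simp]: "(- 1) *\<^sub>C x = - (x :: 'a::complex_hilbert)"
  using scaleR_scaleC[of "-1" x] by simp

lemma scaleC_zero_right [simp]: "c *\<^sub>C 0 = (0 :: 'a::complex_hilbert)"
  using linear_0[OF bounded_linear.linear[OF bounded_linear_scaleC]] .

lemma scaleC_diff_right: "c *\<^sub>C (x - y) = c *\<^sub>C x - c *\<^sub>C (y :: 'a::complex_hilbert)"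
  using linear_diff[OF bounded_linear.linear[OF bounded_linear_scaleC]] .

lemma scaleC_minus_right: "c *\<^sub>C (- x) = - (c *\<^sub>C (x :: 'a::complex_hilbert))"
  using linear_neg[OF bounded_linear.linear[OF bounded_linear_scaleC]] .

lemma cinner_minus_left [simp]: "cinner (- x) y = - cinner (x :: 'a::complex_hilbert) y"
  using cinner_scaleC_left[of "-1" x y] by simp

lemma cinner_minus_right [simp]: "cinner x (- y) = - cinner (x :: 'a::complex_hilbert) y"
  using cinner_scaleC_right[of x "-1" y] by simp

lemma cinner_diff_left: "cinner (x - y) z = cinner x z - cinner (y :: 'a::complex_hilbert) z"
  using cinner_add_left[of x "- y" z] by simp

lemma cinner_diff_right: "cinner x (y - z) = cinner x y - cinner (x :: 'a::complex_hilbert) z"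
  using cinner_add_right[of x y "- z"] by simp

lemma cinner_zero_left [simp]: "cinner 0 (y :: 'a::complex_hilbert) = 0"
  using cinner_diff_left[of y y y] by simp

lemma cinner_zero_right [simp]: "cinner (y :: 'a::complex_hilbert) 0 = 0"
  using cinner_diff_right[of y y y] by simp

lemma power2_norm_add:
  "(norm (x + y))\<^sup>2 = (norm x)\<^sup>2 + 2 * Re (cinner x y) + (norm (y :: 'a::complex_hilbert))\<^sup>2"
proof -
  have "cinner (x + y) (x + y) = cinner x x + cinner x y + cnj (cinner x y) + cinner y y"
    by (simp add: cinner_add_left cinner_add_right flip: cinner_commute)
  from arg_cong[OF this, of Re] show ?thesis
    by (simp add: cinner_self)
qed

lemma power2_norm_diff:
  "(norm (x - y))\<^sup>2 = (norm x)\<^sup>2 - 2 * Re (cinner x y) + (norm (y :: 'a::complex_hilbert))\<^sup>2"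
  using power2_norm_add[of x "- y"] by simp

lemma parallelogram_law:
  "(norm (x + y))\<^sup>2 + (norm (x - y))\<^sup>2 = 2 * (norm x)\<^sup>2 + 2 * (norm (y :: 'a::complex_hilbert))\<^sup>2"
  by (simp add: power2_norm_add power2_norm_diff)

text \<open>Meant for \<open>c = cinner x y / (norm y)^2\<close>, the coefficient of the projection
  of \<open>x\<close> on \<open>y\<close>: the cross term in the expansion of
  \<open>norm (x - c y)^2\<close> becomes a real number.\<close>

lemma cnj_mult_divide_of_real:
  assumes "c = a / of_real r" "r \<noteq> 0"
  shows "cnj c * a = of_real ((cmod c)\<^sup>2 * r)"
proof -
  have "a = c * of_real r"
    using assms by simp
  then show ?thesis
    by (simp add: complex_norm_square mult_ac del: of_real_power)
qed

lemma cinner_Cauchy_Schwarz: "cmod (cinner x y) \<le> norm x * norm (y :: 'a::complex_hilbert)"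
proof (cases "y = 0")
  case False
  define c where "c = cinner x y / of_real ((norm y)\<^sup>2)"
  have c: "cmod c * (norm y)\<^sup>2 = cmod (cinner x y)"
    using False by (simp add: c_def norm_divide norm_power)
  have cc: "cnj c * cinner x y = of_real ((cmod c)\<^sup>2 * (norm y)\<^sup>2)"
    using False by (intro cnj_mult_divide_of_real[OF c_def]) simp
  have "0 \<le> (norm (x - c *\<^sub>C y))\<^sup>2"
    by simp
  also have "\<dots> = (norm x)\<^sup>2 - 2 * Re (cnj c * cinner x y) + (cmod c * norm y)\<^sup>2"
    by (simp add: power2_norm_diff cinner_scaleC_right norm_scaleC)
  also have "\<dots> = (norm x)\<^sup>2 - (cmod c * norm y)\<^sup>2"
    unfolding cc by (simp add: power_mult_distrib)
  finally have "(cmod c * norm y)\<^sup>2 \<le> (norm x)\<^sup>2"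
    by simp
  then have "cmod c * norm y \<le> norm x"
    by (rule power2_le_imp_le) simp
  then have "cmod c * norm y * norm y \<le> norm x * norm y"
    by (rule mult_right_mono) simp
  then show ?thesis
    using c by (simp add: power2_eq_square mult.assoc)
qed simp

lemma bounded_bilinear_cinner:
  "bounded_bilinear (cinner :: 'a::complex_hilbert \<Rightarrow> 'a \<Rightarrow> complex)"
proof
  show "\<exists>K. \<forall>(a::'a) b. norm (cinner a b) \<le> norm a * norm b * K"
    using cinner_Cauchy_Schwarz by (intro exI[of _ 1]) auto
qed (auto simp: cinner_add_left cinner_add_right scaleR_scaleC cinner_scaleC_left
    cinner_scaleC_right scaleC_complex_def)

lemmas tendsto_cinner [tendsto_intros] = bounded_bilinear.tendsto[OF bounded_bilinear_cinner]
lemmas continuous_on_cinner [continuous_intros] =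
  bounded_bilinear.continuous_on[OF bounded_bilinear_cinner]
lemmas continuous_on_scaleC [continuous_intros] =
  bounded_linear.continuous_on[OF bounded_linear_scaleC]

lemma cinner_left_eqI:
  assumes "\<And>z. cinner x z = cinner y z" shows "x = (y :: 'a::complex_hilbert)"
proof -
  have "cinner (x - y) (x - y) = 0"
    using assms by (simp add: cinner_diff_left)
  then show ?thesis
    by (simp add: cinner_self)
qed

lemma cinner_right_eqI:
  assumes "\<And>z. cinner z x = cinner z y" shows "x = (y :: 'a::complex_hilbert)"
proof (rule cinner_left_eqI)
  show "cinner x z = cinner y z" for z
    using assms[of z] cinner_commute[of x z] cinner_commute[of y z] by simp
qed

text \<open>A minimising sequence is Cauchy by the parallelogram law; completeness and closedness
  then supply the minimiser.\<close>

lemma exists_closest_point_subspace: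
  fixes V :: "'a::complex_hilbert set"
  assumes "closed V" "0 \<in> V" and add: "\<And>x y. x \<in> V \<Longrightarrow> y \<in> V \<Longrightarrow> x + y \<in> V"
    and scale: "\<And>c x. x \<in> V \<Longrightarrow> c *\<^sub>C x \<in> V"
  shows "\<exists>p\<in>V. \<forall>v\<in>V. norm (x - p) \<le> norm (x - v)"
proof -
  define d where "d = (INF v\<in>V. norm (x - v))"
  have bdd: "bdd_below ((\<lambda>v. norm (x - v)) ` V)"
    by (intro bdd_belowI[of _ 0]) auto
  have d_le: "d \<le> norm (x - v)" if "v \<in> V" for v
    unfolding d_def using bdd that by (rule cINF_lower)
  have d0: "0 \<le> d"
    unfolding d_def using \<open>0 \<in> V\<close> by (intro cINF_greatest) auto
  have "\<exists>v\<in>V. norm (x - v) < d + inverse (real (Suc n))" for n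
    using cInf_lessD[of "(\<lambda>v. norm (x - v)) ` V" "d + inverse (real (Suc n))"] \<open>0 \<in> V\<close>
    unfolding d_def by auto
  then obtain v where v: "\<And>n. v n \<in> V" "\<And>n. norm (x - v n) < d + inverse (real (Suc n))"
    by metis
  have lim: "(\<lambda>n. norm (x - v n)) \<longlonglongrightarrow> d"
  proof (rule tendsto_sandwich[where f = "\<lambda>n. d" and h = "\<lambda>n. d + inverse (real (Suc n))"])
    show "(\<lambda>n. d + inverse (real (Suc n))) \<longlonglongrightarrow> d"
      using tendsto_add[OF tendsto_const LIMSEQ_inverse_real_of_nat, of d] by simp
    show "(\<lambda>n. d) \<longlonglongrightarrow> d" by simp
  qed (use d_le v in \<open>auto intro!: always_eventually less_imp_le\<close>)
  \<comment> \<open>Parallelogram law for \<open>x - v m\<close> and \<open>x - v n\<close>: the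
    midpoint of \<open>v m\<close> and \<open>v n\<close> is in \<open>V\<close>, so the sum of the
    two vectors has norm at least \<open>2 d\<close>.\<close>
  have close: "(norm (v m - v n))\<^sup>2 \<le> 2 * (norm (x - v m))\<^sup>2 + 2 * (norm (x - v n))\<^sup>2 - 4 * d\<^sup>2"
    for m n
  proof -
    let ?w = "(1/2::complex) *\<^sub>C (v m + v n)"
    have "2 * d \<le> 2 * norm (x - ?w)"
      using d_le[of ?w] v add scale by simp
    also have "\<dots> = norm ((2::real) *\<^sub>R (x - ?w))"
      by simp
    also have "(2::real) *\<^sub>R (x - ?w) = (x - v m) + (x - v n)"
      by (simp add: scaleR_diff_right scaleR_scaleC[of 2 ?w] scaleC_scaleC) (simp add: scaleR_2)
    finally have "(2 * d)\<^sup>2 \<le> (norm ((x - v m) + (x - v n)))\<^sup>2"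
      using d0 by (intro power_mono) auto
    moreover have "norm ((x - v m) - (x - v n)) = norm (v m - v n)"
      by (simp add: norm_minus_commute)
    ultimately show ?thesis
      using parallelogram_law[of "x - v m" "x - v n"] by (simp add: power_mult_distrib)
  qed
  have "Cauchy v"
  proof (rule metric_CauchyI)
    fix e :: real assume "e > 0"
    have "(\<lambda>n. (norm (x - v n))\<^sup>2) \<longlonglongrightarrow> d\<^sup>2"
      by (intro tendsto_intros lim)
    \<comment> \<open>With slack \<open>e^2 / 4\<close> in both squared distances the bound
      \<open>close\<close> yields exactly \<open>e^2\<close>.\<close>
    then have "\<forall>\<^sub>F n in sequentially. (norm (x - v n))\<^sup>2 < d\<^sup>2 + e\<^sup>2 / 4"
      by (rule order_tendstoD) (use \<open>e > 0\<close> in simp)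
    then obtain N where N: "\<And>n. n \<ge> N \<Longrightarrow> (norm (x - v n))\<^sup>2 < d\<^sup>2 + e\<^sup>2 / 4"
      unfolding eventually_sequentially by blast
    have "dist (v m) (v n) < e" if "m \<ge> N" "n \<ge> N" for m n
    proof -
      have "(norm (v m - v n))\<^sup>2 < e\<^sup>2"
        using close[of m n] N[OF that(1)] N[OF that(2)] by linarith
      then show ?thesis
        using \<open>e > 0\<close> by (simp add: dist_norm power_less_imp_less_base)
    qed
    then show "\<exists>N. \<forall>m\<ge>N. \<forall>n\<ge>N. dist (v m) (v n) < e"
      by blast
  qed
  then obtain p where p: "v \<longlonglongrightarrow> p"
    using Cauchy_convergent_iff convergent_def by blast
  have "p \<in> V"
    using closed_sequentially[OF \<open>closed V\<close> v(1) p] .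
  moreover have "norm (x - p) = d"
    by (rule LIMSEQ_unique[OF _ lim]) (intro tendsto_intros p)
  ultimately show ?thesis
    using d_le by blast
qed

text \<open>The closest point gives an orthogonal decomposition. Its uniqueness makes the map
  linear, and Pythagoras makes it contractive.\<close>

lemma exists_orthogonal_projection:
  fixes V :: "'a::complex_hilbert set"
  assumes "closed V" "0 \<in> V" and add: "\<And>x y. x \<in> V \<Longrightarrow> y \<in> V \<Longrightarrow> x + y \<in> V"
    and scale: "\<And>c x. x \<in> V \<Longrightarrow> c *\<^sub>C x \<in> V"
  shows "\<exists>E\<in>bounded_ops. (\<forall>x. blinfun_apply E x \<in> V) \<and>
    (\<forall>x. \<forall>v\<in>V. cinner (x - blinfun_apply E x) v = 0)"
proof -
  have diff: "x - y \<in> V" if "x \<in> V" "y \<in> V" for x y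
    using add[OF that(1) scale[OF that(2), of "-1"]] by simp
  have "\<exists>p\<in>V. \<forall>v\<in>V. cinner (x - p) v = 0" for x
  proof -
    obtain p where p: "p \<in> V" "\<And>v. v \<in> V \<Longrightarrow> norm (x - p) \<le> norm (x - v)"
      using exists_closest_point_subspace[OF assms] by blast
    have "cinner (x - p) v = 0" if "v \<in> V" for v
    proof (cases "v = 0")
      case False
      \<comment> \<open>Moving \<open>p\<close> by \<open>c v\<close> would lower the squared
        distance by the square of \<open>norm (c v)\<close>, so minimality forces
        \<open>c = 0\<close>.\<close>
      define c where "c = cinner (x - p) v / of_real ((norm v)\<^sup>2)"
      have cc: "cnj c * cinner (x - p) v = of_real ((cmod c)\<^sup>2 * (norm v)\<^sup>2)"
        using False by (intro cnj_mult_divide_of_real[OF c_def]) simp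
      have "(norm (x - p))\<^sup>2 \<le> (norm ((x - p) - c *\<^sub>C v))\<^sup>2"
        using p(2)[of "p + c *\<^sub>C v"] add[OF p(1) scale[OF that]]
        by (intro power_mono) (auto simp: algebra_simps)
      also have "\<dots> = (norm (x - p))\<^sup>2 - 2 * Re (cnj c * cinner (x - p) v) + (cmod c * norm v)\<^sup>2"
        by (simp add: power2_norm_diff[of "x - p"] cinner_scaleC_right norm_scaleC)
      also have "\<dots> = (norm (x - p))\<^sup>2 - (cmod c * norm v)\<^sup>2"
        unfolding cc by (simp add: power_mult_distrib)
      finally have "cmod c * norm v = 0"
        by simp
      with False show ?thesis
        by (auto simp: c_def)
    qed simp
    with p(1) show ?thesis by blast
  qed
  then obtain e where e: "\<And>x. e x \<in> V" "\<And>x v. v \<in> V \<Longrightarrow> cinner (x - e x) v = 0"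
    by metis
  have uniq: "e x = p" if "p \<in> V" "\<And>v. v \<in> V \<Longrightarrow> cinner (x - p) v = 0" for x p
  proof -
    have "cinner (e x - p) (e x - p) = cinner (x - p) (e x - p) - cinner (x - e x) (e x - p)"
      by (simp add: cinner_diff_left)
    also have "\<dots> = 0"
      using that e diff by simp
    finally show ?thesis by (simp add: cinner_self)
  qed
  have e_add: "e (x + y) = e x + e y" for x y
  proof (rule uniq)
    fix v assume "v \<in> V"
    then show "cinner (x + y - (e x + e y)) v = 0"
      using e(2)[of v x] e(2)[of v y] by (simp add: cinner_diff_left cinner_add_left)
  qed (use e add in auto)
  have e_scale: "e (c *\<^sub>C x) = c *\<^sub>C e x" for c x
  proof (rule uniq)
    fix v assume "v \<in> V"
    then show "cinner (c *\<^sub>C x - c *\<^sub>C e x) v = 0"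
      using e(2)[of v x] by (simp add: cinner_scaleC_left flip: scaleC_diff_right)
  qed (use e scale in auto)
  have e_norm: "norm (e x) \<le> norm x" for x
  proof -
    have "(norm x)\<^sup>2 = (norm ((x - e x) + e x))\<^sup>2"
      by simp
    also have "\<dots> = (norm (x - e x))\<^sup>2 + (norm (e x))\<^sup>2"
      by (subst power2_norm_add) (simp add: e)
    finally have "(norm (e x))\<^sup>2 \<le> (norm x)\<^sup>2"
      by simp
    then show ?thesis
      by (rule power2_le_imp_le) simp
  qed
  have "bounded_linear e"
    by (rule bounded_linear_intro[of _ 1]) (auto simp: e_add e_scale e_norm scaleR_scaleC)
  then have "blinfun_apply (Blinfun e) = e"
    by (rule bounded_linear_Blinfun_apply)
  then show ?thesis
    using e e_scale by (intro bexI[of _ "Blinfun e"]) (auto simp: bounded_ops_def)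
qed

lemma Riesz_representation:
  fixes g :: "'a::complex_hilbert \<Rightarrow> complex"
  assumes add: "\<And>x y. g (x + y) = g x + g y" and scale: "\<And>c x. g (c *\<^sub>C x) = c * g x"
    and bound: "\<And>x. cmod (g x) \<le> K * norm x"
  shows "\<exists>v. \<forall>x. g x = cinner x v"
proof (cases "\<forall>x. g x = 0")
  case True
  then show ?thesis by (intro exI[of _ 0]) simp
next
  case False
  then obtain u0 where "g u0 \<noteq> 0" by blast
  then have "g (inverse (g u0) *\<^sub>C u0) = 1" by (simp add: scale)
  then obtain u where u: "g u = 1" by blast
  have g: "bounded_linear g"
    by (rule bounded_linear_intro[of _ K])
      (auto simp: add scale scaleR_scaleC bound scaleC_complex_def mult.commute)
  then have "closed {x. g x = 0}"
    using linear_continuous_on by (intro closed_Collect_eq) auto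
  moreover have "g 0 = 0"
    using scale[of 0 0] by simp
  ultimately obtain E where E: "\<And>x. g (blinfun_apply E x) = 0"
      "\<And>x v. g v = 0 \<Longrightarrow> cinner (x - blinfun_apply E x) v = 0"
    using exists_orthogonal_projection[of "{x. g x = 0}"] by (auto simp: add scale)
  \<comment> \<open>The component of \<open>u\<close> orthogonal to the kernel still has value 1.
    Since \<open>x - g x n\<close> lies in the kernel, pairing it with \<open>n\<close> reads off
    \<open>g x\<close>.\<close>
  define n where "n = u - blinfun_apply E u"
  have gd: "g (x - y) = g x - g y" for x y
    using linear_diff[OF bounded_linear.linear[OF g]] .
  have gn: "g n = 1"
    by (simp add: n_def gd E u)
  then have "n \<noteq> 0"
    using \<open>g 0 = 0\<close> by auto
  have "g x = cinner x (of_real (inverse ((norm n)\<^sup>2)) *\<^sub>C n)" for x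
  proof -
    have "cinner n (x - g x *\<^sub>C n) = 0"
      unfolding n_def by (rule E(2)) (simp add: gd scale u E(1))
    then have "cinner (x - g x *\<^sub>C n) n = 0"
      using cinner_commute[of "x - g x *\<^sub>C n" n] by simp
    then have "cinner x n = g x * of_real ((norm n)\<^sup>2)"
      by (simp add: cinner_diff_left cinner_scaleC_left cinner_self)
    then show ?thesis
      using \<open>n \<noteq> 0\<close> by (simp add: cinner_scaleC_right)
  qed
  then show ?thesis by blast
qed

section \<open>Bounded operators and adjoints\<close>

lemma bounded_opsD: "T \<in> bounded_ops \<Longrightarrow> blinfun_apply T (c *\<^sub>C x) = c *\<^sub>C blinfun_apply T x"
  by (simp add: bounded_ops_def)

text \<open>Riesz needs a linear functional, hence the conjugate of \<open>f x\<close> in the proof.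
  The lemma serves adjoints and weak limits alike, since both are known only through their matrix
  coefficients.\<close>

lemma exists_operator_of_form:
  fixes f :: "'a::complex_hilbert \<Rightarrow> 'a \<Rightarrow> complex"
  assumes add_left: "\<And>x y z. f (x + y) z = f x z + f y z"
    and scale_left: "\<And>c x y. f (c *\<^sub>C x) y = c * f x y"
    and add_right: "\<And>x y z. f x (y + z) = f x y + f x z"
    and scale_right: "\<And>c x y. f x (c *\<^sub>C y) = cnj c * f x y"
    and bound: "\<And>x y. cmod (f x y) \<le> K * (norm x * norm y)" and "0 \<le> K"
  shows "\<exists>T\<in>bounded_ops. norm T \<le> K \<and> (\<forall>x y. cinner (blinfun_apply T x) y = f x y)"
proof -
  have "\<exists>v. \<forall>y. cnj (f x y) = cinner y v" for x
    by (rule Riesz_representation[of _ "K * norm x"])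
      (auto simp: add_right scale_right bound mult.assoc)
  then obtain t where "\<And>x y. cnj (f x y) = cinner y (t x)"
    by metis
  then have t: "cinner (t x) y = f x y" for x y
    using cinner_commute[of "t x" y] by (metis complex_cnj_cnj)
  have t_norm: "norm (t x) \<le> K * norm x" for x
  proof (cases "t x = 0")
    case False
    have "(norm (t x))\<^sup>2 = cmod (cinner (t x) (t x))"
      by (simp add: cinner_self norm_power)
    also have "\<dots> \<le> K * (norm x * norm (t x))"
      unfolding t by (rule bound)
    finally show ?thesis
      using False by (simp add: power2_eq_square)
  qed (use \<open>0 \<le> K\<close> in simp)
  have t_add: "t (x + y) = t x + t y" for x y
    by (rule cinner_left_eqI) (simp add: t cinner_add_left add_left)
  have t_scale: "t (c *\<^sub>C x) = c *\<^sub>C t x" for c x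
    by (rule cinner_left_eqI) (simp add: t cinner_scaleC_left scale_left)
  have "bounded_linear t"
    by (rule bounded_linear_intro[of _ K])
      (auto simp: t_add t_scale scaleR_scaleC t_norm mult.commute)
  then have ap: "blinfun_apply (Blinfun t) = t"
    by (rule bounded_linear_Blinfun_apply)
  have "norm (Blinfun t) \<le> K"
    using \<open>0 \<le> K\<close> t_norm by (intro norm_blinfun_bound) (auto simp: ap)
  then show ?thesis
    using t t_scale by (intro bexI[of _ "Blinfun t"]) (auto simp: bounded_ops_def ap)
qed

lemma hadjoint_eqI:
  assumes "\<And>x y. cinner (blinfun_apply T x) y = cinner x (blinfun_apply S y)"
  shows "hadjoint T = S"
  unfolding hadjoint_def
proof (rule the_equality)
  show "\<forall>x y. cinner (blinfun_apply T x) y = cinner x (blinfun_apply S y)"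
    using assms by blast
  fix S' assume S': "\<forall>x y. cinner (blinfun_apply T x) y = cinner x (blinfun_apply S' y)"
  show "S' = S"
    by (rule blinfun_eqI, rule cinner_right_eqI) (use S' assms in metis)
qed

text \<open>\<open>hadjoint\<close> is a definite description and acquires its meaning only once an
  adjoint exists. By conjugate symmetry, the operator of the form \<open>cinner x (T y)\<close> is
  one.\<close>

lemma hadjoint_exists:
  fixes T :: "'a::complex_hilbert \<Rightarrow>\<^sub>L 'a"
  assumes "T \<in> bounded_ops"
  shows "hadjoint T \<in> bounded_ops \<and> norm (hadjoint T) \<le> norm T \<and>
    (\<forall>x y. cinner (blinfun_apply T x) y = cinner x (blinfun_apply (hadjoint T) y))"
proof -
  have "\<exists>S\<in>bounded_ops. norm S \<le> norm T \<and>
    (\<forall>x y. cinner (blinfun_apply S x) y = cinner x (blinfun_apply T y))"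
  proof (rule exists_operator_of_form)
    fix x y
    have "cmod (cinner x (blinfun_apply T y)) \<le> norm x * norm (blinfun_apply T y)"
      by (rule cinner_Cauchy_Schwarz)
    also have "\<dots> \<le> norm x * (norm T * norm y)"
      by (intro mult_left_mono norm_blinfun) simp
    finally show "cmod (cinner x (blinfun_apply T y)) \<le> norm T * (norm x * norm y)"
      by (simp add: mult_ac)
  qed (auto simp: cinner_add_left cinner_add_right cinner_scaleC_left cinner_scaleC_right
      blinfun.add_right bounded_opsD[OF assms])
  then obtain S where S: "S \<in> bounded_ops" "norm S \<le> norm T"
    "\<And>x y. cinner (blinfun_apply S x) y = cinner x (blinfun_apply T y)" by blast
  have "cinner (blinfun_apply T x) y = cinner x (blinfun_apply S y)" for x y
    using S(3)[of y x] cinner_commute[of "blinfun_apply T x" y]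
      cinner_commute[of x "blinfun_apply S y"] by simp
  moreover from this have "hadjoint T = S" by (rule hadjoint_eqI)
  ultimately show ?thesis using S by blast
qed

lemma hadjoint_in_bounded_ops [simp]: "T \<in> bounded_ops \<Longrightarrow> hadjoint T \<in> bounded_ops"
  using hadjoint_exists by blast

lemma cinner_hadjoint:
  "T \<in> bounded_ops \<Longrightarrow> cinner x (blinfun_apply (hadjoint T) y) = cinner (blinfun_apply T x) y"
  using hadjoint_exists[of T] by simp

lemma cinner_hadjoint_left:
  "T \<in> bounded_ops \<Longrightarrow> cinner (blinfun_apply (hadjoint T) x) y = cinner x (blinfun_apply T y)"
  using cinner_hadjoint[of T y x] cinner_commute[of "blinfun_apply (hadjoint T) x" y]
    cinner_commute[of x "blinfun_apply T y"] by simp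

lemma hadjoint_hadjoint [simp]: "T \<in> bounded_ops \<Longrightarrow> hadjoint (hadjoint T) = T"
  by (intro hadjoint_eqI) (simp add: cinner_hadjoint_left)

lemma norm_hadjoint [simp]: "T \<in> bounded_ops \<Longrightarrow> norm (hadjoint T) = norm T"
  using hadjoint_exists[of T] hadjoint_exists[of "hadjoint T"] by (intro antisym) auto

lemma bounded_ops_closure_properties [simp]:
  "0 \<in> bounded_ops" "id_blinfun \<in> bounded_ops"
  "S \<in> bounded_ops \<Longrightarrow> T \<in> bounded_ops \<Longrightarrow> S + T \<in> bounded_ops"
  "S \<in> bounded_ops \<Longrightarrow> T \<in> bounded_ops \<Longrightarrow> S - T \<in> bounded_ops"
  "T \<in> bounded_ops \<Longrightarrow> - T \<in> bounded_ops"
  "T \<in> bounded_ops \<Longrightarrow> c *\<^sub>C T \<in> bounded_ops"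
  "T \<in> bounded_ops \<Longrightarrow> r *\<^sub>R T \<in> bounded_ops"
  "S \<in> bounded_ops \<Longrightarrow> T \<in> bounded_ops \<Longrightarrow> S o\<^sub>L T \<in> bounded_ops"
  by (simp_all add: bounded_ops_def blinfun.bilinear_simps scaleC_blinfun_apply scaleC_add_right
      scaleC_diff_right scaleC_minus_right scaleC_scaleC scaleR_scaleC mult.commute)

lemma hadjoint_id [simp]: "hadjoint id_blinfun = id_blinfun"
  by (rule hadjoint_eqI) simp

lemma hadjoint_add:
  "S \<in> bounded_ops \<Longrightarrow> T \<in> bounded_ops \<Longrightarrow> hadjoint (S + T) = hadjoint S + hadjoint T"
  by (rule hadjoint_eqI)
    (simp add: blinfun.bilinear_simps cinner_add_left cinner_add_right cinner_hadjoint)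

lemma hadjoint_diff:
  "S \<in> bounded_ops \<Longrightarrow> T \<in> bounded_ops \<Longrightarrow> hadjoint (S - T) = hadjoint S - hadjoint T"
  by (rule hadjoint_eqI)
    (simp add: blinfun.bilinear_simps cinner_diff_left cinner_diff_right cinner_hadjoint)

lemma hadjoint_scaleC: "T \<in> bounded_ops \<Longrightarrow> hadjoint (c *\<^sub>C T) = cnj c *\<^sub>C hadjoint T"
  by (rule hadjoint_eqI)
    (simp add: scaleC_blinfun_apply cinner_scaleC_left cinner_scaleC_right cinner_hadjoint)

lemma hadjoint_compose:
  "S \<in> bounded_ops \<Longrightarrow> T \<in> bounded_ops \<Longrightarrow> hadjoint (S o\<^sub>L T) = hadjoint T o\<^sub>L hadjoint S"
  by (rule hadjoint_eqI) (simp add: cinner_hadjoint)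

lemma scaleR_blinfun_scaleC: "r *\<^sub>R T = complex_of_real r *\<^sub>C (T :: 'a::complex_hilbert \<Rightarrow>\<^sub>L 'a)"
  by (rule blinfun_eqI) (simp add: blinfun.scaleR_left scaleC_blinfun_apply scaleR_scaleC)

lemma blinfun_compose_id [simp]: "T o\<^sub>L id_blinfun = T" "id_blinfun o\<^sub>L T = T"
  by (rule blinfun_eqI, simp)+

lemma blinfun_compose_assoc: "(R o\<^sub>L S) o\<^sub>L T = R o\<^sub>L (S o\<^sub>L T)"
  by (rule blinfun_eqI) simp

section \<open>Commutants and star-subalgebras\<close>

lemma star_subalgebraD:
  assumes "star_subalgebra A"
  shows "A \<subseteq> bounded_ops" "0 \<in> A"
    and "\<And>x y. x \<in> A \<Longrightarrow> y \<in> A \<Longrightarrow> x + y \<in> A"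
    and "\<And>x y. x \<in> A \<Longrightarrow> y \<in> A \<Longrightarrow> x - y \<in> A"
    and "\<And>c x. x \<in> A \<Longrightarrow> c *\<^sub>C x \<in> A"
    and "\<And>r x. x \<in> A \<Longrightarrow> r *\<^sub>R x \<in> A"
    and "\<And>x y. x \<in> A \<Longrightarrow> y \<in> A \<Longrightarrow> x o\<^sub>L y \<in> A"
    and "\<And>x. x \<in> A \<Longrightarrow> hadjoint x \<in> A"
    and "\<And>x. x \<in> A \<Longrightarrow> x \<in> bounded_ops"
proof -
  show R: "r *\<^sub>R x \<in> A" if "x \<in> A" for r x
    using assms that by (simp add: star_subalgebra_def scaleR_blinfun_scaleC)
  show "x - y \<in> A" if "x \<in> A" "y \<in> A" for x y
    using assms that(1) R[OF that(2), of "-1"] unfolding star_subalgebra_def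
    by (metis diff_conv_add_uminus scaleR_minus1_left)
qed (use assms in \<open>auto simp: star_subalgebra_def\<close>)

lemma commutantD:
  assumes "T \<in> commutant A" "x \<in> A"
  shows "blinfun_apply T (blinfun_apply x v) = blinfun_apply x (blinfun_apply T v)"
proof -
  have "T o\<^sub>L x = x o\<^sub>L T"
    using assms by (simp add: commutant_def)
  from arg_cong[OF this, of "\<lambda>S. blinfun_apply S v"] show ?thesis
    by simp
qed

lemma commutantI:
  assumes "T \<in> bounded_ops"
    and "\<And>x v. x \<in> A \<Longrightarrow> blinfun_apply T (blinfun_apply x v) = blinfun_apply x (blinfun_apply T v)"
  shows "T \<in> commutant A"
  unfolding commutant_def using assms by (auto intro!: blinfun_eqI)

lemma commutant_antimono: "A \<subseteq> B \<Longrightarrow> commutant B \<subseteq> commutant A"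
  by (auto simp: commutant_def)

lemma commutant_bounded_ops: "T \<in> commutant A \<Longrightarrow> T \<in> bounded_ops"
  by (simp add: commutant_def)

lemma subset_bicommutant:
  assumes "A \<subseteq> bounded_ops" shows "A \<subseteq> commutant (commutant A)"
  using assms by (auto intro!: commutantI simp: commutantD)

lemma id_in_commutant [simp]: "id_blinfun \<in> commutant A"
  by (intro commutantI) auto

lemma hadjoint_in_commutant:
  assumes A: "A \<subseteq> bounded_ops" "\<And>x. x \<in> A \<Longrightarrow> hadjoint x \<in> A" and T: "T \<in> commutant A"
  shows "hadjoint T \<in> commutant A"
proof (rule commutantI)
  have Tb: "T \<in> bounded_ops"
    using T by (rule commutant_bounded_ops)
  then show "hadjoint T \<in> bounded_ops"
    by simp
  fix x v assume x: "x \<in> A"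
  then have xb: "x \<in> bounded_ops"
    using A by blast
  show "blinfun_apply (hadjoint T) (blinfun_apply x v) = blinfun_apply x (blinfun_apply (hadjoint T) v)"
  proof (rule cinner_right_eqI)
    fix u
    show "cinner u (blinfun_apply (hadjoint T) (blinfun_apply x v)) =
      cinner u (blinfun_apply x (blinfun_apply (hadjoint T) v))"
      using commutantD[OF T A(2)[OF x], of u] Tb xb
      by (simp add: cinner_hadjoint flip: cinner_hadjoint_left)
  qed
qed

lemma star_subalgebra_commutant:
  assumes "A \<subseteq> bounded_ops" "\<And>x. x \<in> A \<Longrightarrow> hadjoint x \<in> A"
  shows "star_subalgebra (commutant A)"
  unfolding star_subalgebra_def
proof (intro conjI ballI allI)
  show "hadjoint T \<in> commutant A" if "T \<in> commutant A" for T
    using assms that by (rule hadjoint_in_commutant)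
  have lin: "x \<in> A \<Longrightarrow> blinfun_apply x (c *\<^sub>C v) = c *\<^sub>C blinfun_apply x v" for x c v
    using assms(1) by (auto intro: bounded_opsD)
  show "c *\<^sub>C T \<in> commutant A" if "T \<in> commutant A" for c T
    using that commutantD[OF that]
    by (auto intro!: commutantI simp: commutant_bounded_ops scaleC_blinfun_apply lin)
  show "S + T \<in> commutant A" "S o\<^sub>L T \<in> commutant A"
    if "S \<in> commutant A" "T \<in> commutant A" for S T
    using that commutantD[OF that(1)] commutantD[OF that(2)]
    by (auto intro!: commutantI simp: commutant_bounded_ops blinfun.bilinear_simps)
qed (auto intro!: commutantI simp: commutant_bounded_ops)

lemma star_subalgebra_bicommutant:
  assumes "star_subalgebra A"
  shows "star_subalgebra (commutant (commutant A))"
  by (intro star_subalgebra_commutant hadjoint_in_commutant)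
    (use star_subalgebraD[OF assms] commutant_bounded_ops in auto)

text \<open>Evaluation at a vector is strongly continuous, so each commutation relation is a closed
  condition. Complex linearity is one of these conditions, because the ambient type consists of
  real-linear operators.\<close>

lemma closedin_sot_commutant:
  fixes A :: "('h::complex_hilbert \<Rightarrow>\<^sub>L 'h) set"
  shows "closedin strong_operator_topology (commutant A)"
proof -
  let ?X = "strong_operator_topology :: ('h \<Rightarrow>\<^sub>L 'h) topology"
  have ev: "continuous_map ?X euclidean (\<lambda>T. f (blinfun_apply T v))"
    if "continuous_on UNIV f" for f :: "'h \<Rightarrow> 'h" and v
    using continuous_map_compose[OF strong_operator_topology_continuous_evaluation, of euclidean f v] that
    by (simp add: o_def)
  have eq: "closedin ?X {T. blinfun_apply T u = f (blinfun_apply T v)}"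
    if "continuous_on UNIV f" for f :: "'h \<Rightarrow> 'h" and u v
    using closedin_continuous_maps_eq[OF _ ev[of "\<lambda>x. x" u] ev[OF that, of v]]
    by (simp add: strong_operator_topology_topspace)
  \<comment> \<open>The identity is inserted because \<open>closedin_INT\<close> needs a nonempty index set.\<close>
  have "commutant A =
      (\<Inter>c. \<Inter>v. {T. blinfun_apply T (c *\<^sub>C v) = c *\<^sub>C blinfun_apply T v}) \<inter>
      (\<Inter>p\<in>insert id_blinfun A. \<Inter>v. {T. blinfun_apply T (blinfun_apply p v) = blinfun_apply p (blinfun_apply T v)})"
    by (auto simp: bounded_ops_def intro!: commutantI dest: commutantD commutant_bounded_ops)
  also have "closedin ?X \<dots>"
    by (intro closedin_Int closedin_INT eq continuous_intros) auto
  finally show ?thesis .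
qed

lemma closed_commutant: "closed (commutant A)"
  using closedin_continuous_map_preimage[OF strong_operator_topology_weaker_than_euclidean
      closedin_sot_commutant[of A]]
  by simp

lemma sot_closure_subset_bicommutant:
  "A \<subseteq> bounded_ops \<Longrightarrow> sot_closure A \<subseteq> commutant (commutant A)"
  by (intro closure_of_minimal subset_bicommutant closedin_sot_commutant)

text \<open>The double commutant argument for a single vector: the projection \<open>E\<close> onto
  the closure of \<open>A v\<close> commutes with \<open>A\<close>, hence with \<open>T\<close>, and
  it fixes \<open>v\<close>, so \<open>T v = E (T v)\<close>.\<close>

lemma bicommutant_apply_in_closure:
  assumes A: "star_subalgebra A" and one: "id_blinfun \<in> A" and T: "T \<in> commutant (commutant A)"
  shows "blinfun_apply T v \<in> closure ((\<lambda>y. blinfun_apply y v) ` A)"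
proof -
  note A' = star_subalgebraD[OF A]
  define V where "V = closure ((\<lambda>y. blinfun_apply y v) ` A)"
  have "\<exists>E\<in>bounded_ops. (\<forall>x. blinfun_apply E x \<in> V) \<and>
    (\<forall>x. \<forall>w\<in>V. cinner (x - blinfun_apply E x) w = 0)"
  proof (rule exists_orthogonal_projection)
    show "closed V" "0 \<in> V"
      using closure_subset[of "(\<lambda>y. blinfun_apply y v) ` A"] A'(2)
      unfolding V_def by (auto intro!: rev_image_eqI[of 0])
    show "c *\<^sub>C x \<in> V" if "x \<in> V" for c x
    proof -
      have "(\<lambda>x. c *\<^sub>C x) ` V \<subseteq> V"
        unfolding V_def
      proof (rule image_closure_subset)
        show "(\<lambda>x. c *\<^sub>C x) ` (\<lambda>y. blinfun_apply y v) ` A \<subseteq> closure ((\<lambda>y. blinfun_apply y v) ` A)"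
          using A'(5) closure_subset[of "(\<lambda>y. blinfun_apply y v) ` A"]
          by (auto simp flip: scaleC_blinfun_apply)
      qed (auto intro: continuous_intros)
      with that show ?thesis by blast
    qed
    show "x + y \<in> V" if xy: "x \<in> V" "y \<in> V" for x y
    proof -
      let ?S = "(\<lambda>y. blinfun_apply y v) ` A"
      obtain f g where fg: "\<forall>n. f n \<in> ?S" "f \<longlonglongrightarrow> x" "\<forall>n. g n \<in> ?S" "g \<longlonglongrightarrow> y"
        using xy unfolding V_def closure_sequential by blast
      have "a + b \<in> ?S" if "a \<in> ?S" "b \<in> ?S" for a b
        using that A'(3) by (auto simp flip: blinfun.add_left)
      then show ?thesis
        unfolding V_def closure_sequential using fg
        by (intro exI[of _ "\<lambda>n. f n + g n"]) (auto intro!: tendsto_intros)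
    qed
  qed
  then obtain E where E: "E \<in> bounded_ops" "\<And>x. blinfun_apply E x \<in> V"
    "\<And>x w. w \<in> V \<Longrightarrow> cinner (x - blinfun_apply E x) w = 0"
    by blast
  have inv: "blinfun_apply a x \<in> V" if "a \<in> A" "x \<in> V" for a x
  proof -
    have "blinfun_apply a ` V \<subseteq> V"
      unfolding V_def
    proof (rule image_closure_subset)
      show "blinfun_apply a ` (\<lambda>y. blinfun_apply y v) ` A \<subseteq> closure ((\<lambda>y. blinfun_apply y v) ` A)"
        using A'(7)[OF that(1)] closure_subset[of "(\<lambda>y. blinfun_apply y v) ` A"]
        by (auto simp flip: blinfun_apply_blinfun_compose)
    qed (auto intro: continuous_intros)
    with that show ?thesis by blast
  qed
  have uniq: "blinfun_apply E x = p"
    if "p \<in> V" "\<And>w. w \<in> V \<Longrightarrow> cinner (x - p) w = 0" for x p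
  proof -
    have 1: "cinner (blinfun_apply E x - p) w = 0" if "w \<in> V" for w
      using \<open>\<And>w. w \<in> V \<Longrightarrow> cinner (x - p) w = 0\<close>[OF that] E(3)[OF that, of x]
      by (simp add: cinner_diff_left)
    have "cinner (blinfun_apply E x - p) (blinfun_apply E x - p) = 0"
      using 1[OF E(2)[of x]] 1[OF that(1)] by (subst cinner_diff_right) simp
    then show ?thesis by (simp add: cinner_self)
  qed
  have "E \<in> commutant A"
  proof (rule commutantI[OF E(1)])
    fix a x assume a: "a \<in> A"
    show "blinfun_apply E (blinfun_apply a x) = blinfun_apply a (blinfun_apply E x)"
    proof (rule uniq)
      show "blinfun_apply a (blinfun_apply E x) \<in> V"
        using a E inv by blast
      fix w assume "w \<in> V"
      \<comment> \<open>As \<open>A\<close> is closed under adjoints, the orthogonal complement of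
        \<open>V\<close> is invariant too.\<close>
      then have "cinner (x - blinfun_apply E x) (blinfun_apply (hadjoint a) w) = 0"
        using E(3) inv A'(8)[OF a] by blast
      then show "cinner (blinfun_apply a x - blinfun_apply a (blinfun_apply E x)) w = 0"
        using A'(9)[OF a] by (simp add: cinner_hadjoint flip: blinfun.diff_right)
    qed
  qed
  have "v \<in> V"
    unfolding V_def using one by (intro subsetD[OF closure_subset]) (auto intro!: rev_image_eqI)
  then have "blinfun_apply E v = v"
    by (intro uniq) auto
  then have "blinfun_apply T v = blinfun_apply E (blinfun_apply T v)"
    using commutantD[OF T \<open>E \<in> commutant A\<close>, of v] by simp
  then show ?thesis
    using E(2)[of "blinfun_apply T v"] by (simp add: V_def)
qed

section \<open>A bounded rational transform of operators\<close>

text \<open>All three rest on \<open>cinner v (y^* y v)\<close> being the square of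
  \<open>norm (y v)\<close>. The second is the operator form of \<open>2 t \<le> 1 + t^2\<close>,
  obtained from the square of \<open>norm (v - y^* y v)\<close>; it is what makes the transform a
  contraction.\<close>

lemma norm_le_id_plus_square:
  assumes "y \<in> bounded_ops"
  shows "norm v \<le> norm (v + blinfun_apply (hadjoint y) (blinfun_apply y v))"
    and "2 * norm (blinfun_apply y v) \<le> norm (v + blinfun_apply (hadjoint y) (blinfun_apply y v))"
    and "(norm v)\<^sup>2 \<le> Re (cinner (v + blinfun_apply (hadjoint y) (blinfun_apply y v)) v)"
proof -
  let ?q = "blinfun_apply (hadjoint y) (blinfun_apply y v)"
  have c: "cinner v ?q = of_real ((norm (blinfun_apply y v))\<^sup>2)"
    using assms by (simp add: cinner_hadjoint cinner_self)
  have "(norm v)\<^sup>2 \<le> (norm (v + ?q))\<^sup>2"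
    by (simp add: power2_norm_add c)
  then show "norm v \<le> norm (v + ?q)"
    by (rule power2_le_imp_le) simp
  have "0 \<le> (norm (v - ?q))\<^sup>2"
    by simp
  then have "(2 * norm (blinfun_apply y v))\<^sup>2 \<le> (norm (v + ?q))\<^sup>2"
    by (simp add: power2_norm_add power2_norm_diff c power_mult_distrib)
  then show "2 * norm (blinfun_apply y v) \<le> norm (v + ?q)"
    by (rule power2_le_imp_le) simp
  have "cinner ?q v = of_real ((norm (blinfun_apply y v))\<^sup>2)"
    using assms by (simp add: cinner_hadjoint_left cinner_self)
  then show "(norm v)\<^sup>2 \<le> Re (cinner (v + ?q) v)"
    by (simp add: cinner_add_left cinner_self)
qed

text \<open>The inverse is the fixed point of \<open>X \<mapsto> X - c D X + c\<close> with \<open>D = 1 + y\<^sup>* y\<close>, a strict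
  contraction for small \<open>c > 0\<close> because \<open>D \<ge> 1\<close>.\<close>

lemma exists_inverse_id_plus_square:
  assumes A: "star_subalgebra A" and one: "id_blinfun \<in> A" and y: "y \<in> A"
  shows "\<exists>B\<in>closure A. norm B \<le> 1 \<and> (id_blinfun + (hadjoint y o\<^sub>L y)) o\<^sub>L B = id_blinfun \<and>
    B o\<^sub>L (id_blinfun + (hadjoint y o\<^sub>L y)) = id_blinfun"
proof -
  note A' = star_subalgebraD[OF A]
  have yb: "y \<in> bounded_ops"
    using A' y by blast
  define D where "D = id_blinfun + (hadjoint y o\<^sub>L y)"
  have D: "blinfun_apply D v = v + blinfun_apply (hadjoint y) (blinfun_apply y v)" for v
    by (simp add: D_def blinfun.add_left)
  note lower = norm_le_id_plus_square[OF yb, folded D]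
  have "D \<in> A"
    unfolding D_def by (intro A'(3-8) one y)
  \<comment> \<open>Since \<open>c (norm D)^2 \<le> 1\<close>, the quadratic term in the expansion
    of \<open>norm (v - c D v)^2\<close> is at most \<open>c (norm v)^2\<close>, while the linear
    term subtracts at least \<open>2 c (norm v)^2\<close>. This leaves the factor
    \<open>1 - c\<close>.\<close>
  define c where "c = 1 / (1 + (norm D)\<^sup>2)"
  have den: "1 + (norm D)\<^sup>2 > 0"
    by (simp add: add_pos_nonneg)
  have c: "0 < c" "c \<le> 1" "c * (norm D)\<^sup>2 \<le> 1"
    using den by (auto simp: c_def divide_simps)
  have contr: "norm (id_blinfun - c *\<^sub>R D) \<le> sqrt (1 - c)"
  proof (rule norm_blinfun_bound)
    fix v
    have "(norm (blinfun_apply (id_blinfun - c *\<^sub>R D) v))\<^sup>2 =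
        (norm v)\<^sup>2 - 2 * c * Re (cinner v (blinfun_apply D v)) + c * c * (norm (blinfun_apply D v))\<^sup>2"
      using c by (simp add: blinfun.diff_left blinfun.scaleR_left power2_norm_diff scaleR_scaleC
          cinner_scaleC_right norm_scaleC power_mult_distrib) (simp add: power2_eq_square)
    also have "Re (cinner v (blinfun_apply D v)) = Re (cinner (blinfun_apply D v) v)"
      by (subst cinner_commute) simp
    also have "c * c * (norm (blinfun_apply D v))\<^sup>2 \<le> c * (norm v)\<^sup>2"
    proof -
      have "(norm (blinfun_apply D v))\<^sup>2 \<le> (norm D)\<^sup>2 * (norm v)\<^sup>2"
        using power_mono[OF norm_blinfun[of D v], of 2] by (simp add: power_mult_distrib)
      then have "c * (norm (blinfun_apply D v))\<^sup>2 \<le> (c * (norm D)\<^sup>2) * (norm v)\<^sup>2"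
        using c by (simp add: mult.assoc)
      also have "\<dots> \<le> 1 * (norm v)\<^sup>2"
        by (intro mult_right_mono c) simp
      finally show ?thesis
        using c by (simp add: mult.assoc)
    qed
    also have "(norm v)\<^sup>2 - 2 * c * Re (cinner (blinfun_apply D v) v) + c * (norm v)\<^sup>2 \<le> (1 - c) * (norm v)\<^sup>2"
      using mult_left_mono[OF lower(3)[of v], of c] c by (simp add: algebra_simps)
    finally have "(norm (blinfun_apply (id_blinfun - c *\<^sub>R D) v))\<^sup>2 \<le> (sqrt (1 - c) * norm v)\<^sup>2"
      using c by (simp add: power_mult_distrib)
    then show "norm (blinfun_apply (id_blinfun - c *\<^sub>R D) v) \<le> sqrt (1 - c) * norm v"
      by (rule power2_le_imp_le) (use c in simp)
  qed (use c in simp)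
  define f where "f X = X - c *\<^sub>R (D o\<^sub>L X) + c *\<^sub>R id_blinfun" for X
  have "\<exists>!X. X \<in> closure A \<and> f X = X"
  proof (rule Banach_fix)
    show "complete (closure A)" "closure A \<noteq> {}"
      using one closure_subset by (auto simp: complete_eq_closed)
    show "0 \<le> sqrt (1 - c)" "sqrt (1 - c) < 1"
      using c by auto
    have "continuous_on UNIV f"
      unfolding f_def by (intro continuous_intros)
    moreover have "f ` A \<subseteq> closure A"
      unfolding f_def using closure_subset[of A] by (auto intro!: A'(3-8) one \<open>D \<in> A\<close> elim!: subsetD)
    ultimately show "f ` closure A \<subseteq> closure A"
      by (intro image_closure_subset) (auto intro: continuous_on_subset)
    fix X Y
    have "f X - f Y = (id_blinfun - c *\<^sub>R D) o\<^sub>L (X - Y)"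
      by (rule blinfun_eqI) (simp add: f_def blinfun.bilinear_simps algebra_simps)
    then show "dist (f X) (f Y) \<le> sqrt (1 - c) * dist X Y"
      using norm_blinfun_compose[of "id_blinfun - c *\<^sub>R D" "X - Y"]
        mult_right_mono[OF contr, of "norm (X - Y)"] by (simp add: dist_norm)
  qed
  then obtain B where B: "B \<in> closure A" "f B = B"
    by blast
  have DB: "D o\<^sub>L B = id_blinfun"
    using B(2) c by (simp add: f_def)
  have DBv: "blinfun_apply D (blinfun_apply B v) = v" for v
    using arg_cong[OF DB, of "\<lambda>T. blinfun_apply T v"] by simp
  \<comment> \<open>The fixed point equation gives only a right inverse. But \<open>D\<close>
    annihilates \<open>B D v - v\<close> and is bounded below.\<close>
  have "B o\<^sub>L D = id_blinfun"
  proof (rule blinfun_eqI)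
    fix v
    have "norm (blinfun_apply B (blinfun_apply D v) - v) \<le>
        norm (blinfun_apply D (blinfun_apply B (blinfun_apply D v) - v))"
      by (rule lower)
    also have "\<dots> = 0"
      by (simp add: blinfun.diff_right DBv)
    finally show "blinfun_apply (B o\<^sub>L D) v = blinfun_apply id_blinfun v"
      by simp
  qed
  moreover have "norm B \<le> 1"
    using lower(1)[of "blinfun_apply B v" for v] by (intro norm_blinfun_bound) (auto simp: DBv)
  ultimately show ?thesis
    using B DB unfolding D_def by blast
qed

text \<open>The transform \<open>w = 2 (1 + y y\<^sup>*)\<^sup>-\<^sup>1 y = 2 y (1 + y\<^sup>* y)\<^sup>-\<^sup>1\<close> of \<open>y\<close> is always a contraction.\<close>

definition is_transform :: "('h::complex_hilbert \<Rightarrow>\<^sub>L 'h) \<Rightarrow> ('h \<Rightarrow>\<^sub>L 'h) \<Rightarrow> ('h \<Rightarrow>\<^sub>L 'h) \<Rightarrow> bool"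
  where "is_transform y B w \<longleftrightarrow> norm B \<le> 1 \<and> norm w \<le> 1 \<and>
    B o\<^sub>L (id_blinfun + (y o\<^sub>L hadjoint y)) = id_blinfun \<and> w = 2 *\<^sub>R (B o\<^sub>L y)"

text \<open>With \<open>B\<close> inverse to \<open>y y^* + 1\<close> and \<open>C\<close> inverse
  to \<open>1 + y^* y\<close> one has \<open>B y = y C\<close>, so the second bound of
  \<open>norm_le_id_plus_square\<close> at \<open>C v\<close> shows that \<open>2 B y\<close> is a
  contraction. The witnesses live in the norm closure because the fixed point defining
  \<open>B\<close> does.\<close>

lemma exists_transform:
  assumes A: "star_subalgebra A" and one: "id_blinfun \<in> A" and y: "y \<in> A"
  shows "\<exists>B\<in>closure A. \<exists>w\<in>closure A. is_transform y B w"
proof -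
  note A' = star_subalgebraD[OF A]
  have yb: "y \<in> bounded_ops"
    using A' y by blast
  obtain B where B: "B \<in> closure A" "norm B \<le> 1"
      "B o\<^sub>L (id_blinfun + (y o\<^sub>L hadjoint y)) = id_blinfun"
    using exists_inverse_id_plus_square[OF A one A'(8)[OF y]] yb by auto
  obtain C where C: "(id_blinfun + (hadjoint y o\<^sub>L y)) o\<^sub>L C = id_blinfun"
    using exists_inverse_id_plus_square[OF A one y] by auto
  have Cv: "blinfun_apply C v + blinfun_apply (hadjoint y) (blinfun_apply y (blinfun_apply C v)) = v" for v
    using arg_cong[OF C, of "\<lambda>T. blinfun_apply T v"] by (simp add: blinfun.add_left)
  have Bv: "blinfun_apply B (v + blinfun_apply y (blinfun_apply (hadjoint y) v)) = v" for v
    using arg_cong[OF B(3), of "\<lambda>T. blinfun_apply T v"] by (simp add: blinfun.add_left)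
  have BC: "blinfun_apply B (blinfun_apply y v) = blinfun_apply y (blinfun_apply C v)" for v
    using Bv[of "blinfun_apply y (blinfun_apply C v)"] Cv[of v]
    by (simp flip: blinfun.add_right)
  have "norm (2 *\<^sub>R (B o\<^sub>L y)) \<le> 1"
  proof (rule norm_blinfun_bound)
    show "norm (blinfun_apply (2 *\<^sub>R (B o\<^sub>L y)) v) \<le> 1 * norm v" for v
      using norm_le_id_plus_square(2)[OF yb, of "blinfun_apply C v"]
      by (simp add: blinfun.scaleR_left BC Cv)
  qed simp
  moreover have "2 *\<^sub>R (B o\<^sub>L y) \<in> closure A"
  proof -
    have "(\<lambda>X. 2 *\<^sub>R (X o\<^sub>L y)) ` closure A \<subseteq> closure A"
      using closure_subset[of A]
      by (intro image_closure_subset continuous_intros) (auto intro!: A'(6,7) y elim!: subsetD)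
    with B show ?thesis by blast
  qed
  ultimately show ?thesis
    using B unfolding is_transform_def by blast
qed

text \<open>On the unit ball \<open>z^* z\<close> depends on \<open>z\<close> with Lipschitz
  constant 2, and \<open>1 + z^* z\<close> has norm at most 2. After the factor \<open>1/2\<close>
  the map \<open>f\<close> preserves the ball and contracts by \<open>norm x\<close>, which is where
  strictness enters.\<close>

lemma exists_transform_preimage:
  assumes A: "star_subalgebra A" "closed A" and one: "id_blinfun \<in> A" and x: "x \<in> A" "norm x < 1"
  shows "\<exists>z\<in>A. 2 *\<^sub>R z = x o\<^sub>L (id_blinfun + (hadjoint z o\<^sub>L z))"
proof -
  note A' = star_subalgebraD[OF A(1)]
  define f where "f z = (1/2) *\<^sub>R (x o\<^sub>L (id_blinfun + (hadjoint z o\<^sub>L z)))" for z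
  define S where "S = A \<inter> cball 0 1"
  have "\<exists>!z. z \<in> S \<and> f z = z"
  proof (rule Banach_fix)
    show "complete S" "S \<noteq> {}"
      using A A'(2) by (auto simp: S_def complete_eq_closed)
    show "0 \<le> norm x" "norm x < 1"
      using x by auto
    show "f ` S \<subseteq> S"
    proof (intro subsetI, elim imageE)
      fix w z assume w: "w = f z" and "z \<in> S"
      then have z: "z \<in> A" "norm z \<le> 1"
        by (auto simp: S_def)
      have "norm (hadjoint z o\<^sub>L z) \<le> norm z * norm z"
        using norm_blinfun_compose[of "hadjoint z" z] z A' by simp
      also have "\<dots> \<le> 1"
        using z by (simp add: mult_le_one)
      finally have "norm (id_blinfun + (hadjoint z o\<^sub>L z)) \<le> 1 + 1"
        by (intro norm_triangle_mono norm_blinfun_id_le)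
      then have "norm x * norm (id_blinfun + (hadjoint z o\<^sub>L z)) \<le> 1 * 2"
        using x by (intro mult_mono) auto
      then have "norm (f z) \<le> 1"
        using norm_blinfun_compose[of x "id_blinfun + (hadjoint z o\<^sub>L z)"] by (simp add: f_def)
      moreover have "f z \<in> A"
        unfolding f_def by (intro A'(3-8) one x z)
      ultimately show "w \<in> S"
        by (simp add: w S_def)
    qed
    fix z u assume "z \<in> S" "u \<in> S"
    then have zu: "z \<in> A" "norm z \<le> 1" "u \<in> A" "norm u \<le> 1" "z \<in> bounded_ops" "u \<in> bounded_ops"
      using A' by (auto simp: S_def)
    have "(hadjoint z o\<^sub>L z) - (hadjoint u o\<^sub>L u) = (hadjoint z o\<^sub>L (z - u)) + (hadjoint (z - u) o\<^sub>L u)"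
      by (rule blinfun_eqI) (simp add: hadjoint_diff zu blinfun.bilinear_simps)
    also have "norm \<dots> \<le> norm (z - u) + norm (z - u)"
    proof (rule norm_triangle_mono)
      have "norm (hadjoint z o\<^sub>L (z - u)) \<le> norm (hadjoint z) * norm (z - u)"
        by (rule norm_blinfun_compose)
      also have "\<dots> \<le> 1 * norm (z - u)"
        using zu by (intro mult_right_mono) auto
      finally show "norm (hadjoint z o\<^sub>L (z - u)) \<le> norm (z - u)"
        by simp
      have "norm (hadjoint (z - u) o\<^sub>L u) \<le> norm (hadjoint (z - u)) * norm u"
        by (rule norm_blinfun_compose)
      also have "\<dots> \<le> norm (z - u) * 1"
        using zu by (intro mult_mono) auto
      finally show "norm (hadjoint (z - u) o\<^sub>L u) \<le> norm (z - u)"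
        by simp
    qed
    finally have le: "norm ((hadjoint z o\<^sub>L z) - (hadjoint u o\<^sub>L u)) \<le> 2 * norm (z - u)"
      by simp
    have "f z - f u = (1/2) *\<^sub>R (x o\<^sub>L ((hadjoint z o\<^sub>L z) - (hadjoint u o\<^sub>L u)))"
      by (rule blinfun_eqI) (simp add: f_def blinfun.bilinear_simps algebra_simps)
    also have "norm \<dots> \<le> (1/2) * (norm x * norm ((hadjoint z o\<^sub>L z) - (hadjoint u o\<^sub>L u)))"
      using norm_blinfun_compose by simp
    also have "\<dots> \<le> (1/2) * (norm x * (2 * norm (z - u)))"
      using le by (intro mult_left_mono) auto
    finally show "dist (f z) (f u) \<le> norm x * dist z u"
      by (simp add: dist_norm)
  qed
  then obtain z where z: "z \<in> S" "f z = z"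
    by blast
  have "2 *\<^sub>R z = 2 *\<^sub>R f z"
    using z by simp
  also have "\<dots> = x o\<^sub>L (id_blinfun + (hadjoint z o\<^sub>L z))"
    by (simp add: f_def)
  finally show ?thesis
    using z by (auto simp: S_def)
qed

text \<open>Writing the square root of \<open>1 - a\<close> as \<open>1 - u\<close> turns it into the fixed point equation
  \<open>u = (a + u\<^sup>2) / 2\<close>.\<close>

lemma exists_sqrt_id_minus:
  assumes A: "star_subalgebra A" "closed A" and one: "id_blinfun \<in> A"
    and a: "a \<in> A" "norm a < 1" "hadjoint a = a"
  shows "\<exists>c\<in>A. id_blinfun - a = hadjoint c o\<^sub>L c"
proof -
  note A' = star_subalgebraD[OF A(1)]
  define f where "f u = (1/2) *\<^sub>R (a + (u o\<^sub>L u))" for u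
  \<comment> \<open>On the ball of radius \<open>norm a\<close> the value \<open>f u\<close> has
    norm at most \<open>norm a\<close>, and \<open>f\<close> contracts by \<open>norm a\<close>.
    Self-adjointness is built in so that the root \<open>c = 1 - u\<close> satisfies
    \<open>c^* c = c^2\<close>.\<close>
  define S where "S = {u \<in> A. hadjoint u = u \<and> norm u \<le> norm a}"
  have "\<exists>!u. u \<in> S \<and> f u = u"
  proof (rule Banach_fix)
    \<comment> \<open>Self-adjointness as an identity between continuous forms exhibits
      \<open>S\<close> as closed without any continuity of \<open>hadjoint\<close>.\<close>
    have "S = A \<inter> cball 0 (norm a) \<inter> (\<Inter>v. \<Inter>w. {u. cinner (blinfun_apply u v) w = cinner v (blinfun_apply u w)})"
      (is "_ = ?R")
    proof (intro set_eqI iffI)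
      fix u assume "u \<in> S"
      then have u: "u \<in> A" "norm u \<le> norm a" "hadjoint u = u"
        by (auto simp: S_def)
      then show "u \<in> ?R"
        using cinner_hadjoint[OF A'(9)[OF u(1)]] by auto
    next
      fix u assume u: "u \<in> ?R"
      then have "hadjoint u = u"
        by (intro hadjoint_eqI) auto
      with u show "u \<in> S"
        by (simp add: S_def)
    qed
    also have "closed \<dots>"
      using A by (intro closed_Int closed_INT ballI closed_Collect_eq continuous_intros) auto
    finally show "complete S"
      by (simp add: complete_eq_closed)
    show "S \<noteq> {}"
      using a by (auto simp: S_def)
    show "0 \<le> norm a" "norm a < 1"
      using a by auto
    show "f ` S \<subseteq> S"
    proof (intro subsetI, elim imageE)
      fix w u assume w: "w = f u" and "u \<in> S"
      then have u: "u \<in> A" "norm u \<le> norm a" "hadjoint u = u"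
        by (auto simp: S_def)
      have "norm (u o\<^sub>L u) \<le> norm u * norm u"
        by (rule norm_blinfun_compose)
      also have "\<dots> \<le> norm a * 1"
        using u a by (intro mult_mono) auto
      finally have "norm (a + (u o\<^sub>L u)) \<le> norm a + norm a * 1"
        by (intro norm_triangle_mono) auto
      then have "norm (f u) \<le> norm a"
        by (simp add: f_def)
      moreover have "f u \<in> A"
        unfolding f_def by (intro A'(3-8) a u)
      moreover have "hadjoint (f u) = f u"
        unfolding f_def scaleR_blinfun_scaleC using A' a u
        by (simp add: hadjoint_scaleC hadjoint_add hadjoint_compose)
      ultimately show "w \<in> S"
        by (simp add: w S_def)
    qed
    fix u v assume "u \<in> S" "v \<in> S"
    then have uv: "norm u \<le> norm a" "norm v \<le> norm a"
      by (auto simp: S_def)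
    have "f u - f v = (1/2) *\<^sub>R ((u o\<^sub>L (u - v)) + ((u - v) o\<^sub>L v))"
      by (rule blinfun_eqI) (simp add: f_def blinfun.bilinear_simps algebra_simps)
    moreover have "norm ((u o\<^sub>L (u - v)) + ((u - v) o\<^sub>L v)) \<le> norm a * norm (u - v) + norm (u - v) * norm a"
    proof (rule norm_triangle_mono)
      show "norm (u o\<^sub>L (u - v)) \<le> norm a * norm (u - v)"
        using norm_blinfun_compose[of u "u - v"] mult_right_mono[OF uv(1), of "norm (u - v)"] by simp
      show "norm ((u - v) o\<^sub>L v) \<le> norm (u - v) * norm a"
        using norm_blinfun_compose[of "u - v" v] mult_left_mono[OF uv(2), of "norm (u - v)"] by simp
    qed
    ultimately show "dist (f u) (f v) \<le> norm a * dist u v"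
      by (simp add: dist_norm)
  qed
  then obtain u where u: "u \<in> A" "hadjoint u = u" "f u = u"
    by (auto simp: S_def)
  have "2 *\<^sub>R f u = a + (u o\<^sub>L u)"
    by (simp add: f_def)
  then have "a = 2 *\<^sub>R u - (u o\<^sub>L u)"
    using u(3) by (simp add: algebra_simps)
  then have "id_blinfun - a = (id_blinfun - u) o\<^sub>L (id_blinfun - u)"
    by (intro blinfun_eqI) (simp add: blinfun.bilinear_simps scaleR_2)
  moreover have "hadjoint (id_blinfun - u) = id_blinfun - u"
    using u A' by (simp add: hadjoint_diff)
  moreover have "id_blinfun - u \<in> A"
    by (intro A'(4) u one)
  ultimately show ?thesis
    by (intro bexI[of _ "id_blinfun - u"]) auto
qed

text \<open>The key estimate: with \<open>C = (1 + z\<^sup>* z)\<^sup>-\<^sup>1\<close> and \<open>x = 2 z C\<close> one has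
  \<open>w - x = 2 B (y - z) C + w (z - y)\<^sup>* x / 2\<close>, and a trace vector allows one to move the contractions
  \<open>C\<close> and \<open>x\<close> on the right of \<open>y - z\<close> out of the way.\<close>

lemma transform_trace_vector_estimate:
  assumes N: "star_subalgebra N"
    and trace: "\<And>s. s \<in> N \<Longrightarrow> norm (blinfun_apply (hadjoint s) \<Omega>) = norm (blinfun_apply s \<Omega>)"
    and w: "is_transform y B w" and y: "y \<in> N" and z: "z \<in> N"
    and C: "C \<in> N" "norm C \<le> 1" "(id_blinfun + (hadjoint z o\<^sub>L z)) o\<^sub>L C = id_blinfun"
    and x: "x \<in> N" "norm x \<le> 1" "x = 2 *\<^sub>R (z o\<^sub>L C)"
  shows "norm (blinfun_apply w \<Omega> - blinfun_apply x \<Omega>) \<le> 3 * norm (blinfun_apply y \<Omega> - blinfun_apply z \<Omega>)"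
proof -
  note N' = star_subalgebraD[OF N]
  \<comment> \<open>The trace property turns right factors into left ones:
    \<open>norm (s t \<Omega>) = norm (t^* s^* \<Omega>)\<close>, where \<open>t^*\<close> is a
    contraction.\<close>
  have right_contraction: "norm (blinfun_apply s (blinfun_apply t \<Omega>)) \<le> norm (blinfun_apply s \<Omega>)"
    if "s \<in> N" "t \<in> N" "norm t \<le> 1" for s t
  proof -
    have "norm (blinfun_apply s (blinfun_apply t \<Omega>)) =
        norm (blinfun_apply (hadjoint t) (blinfun_apply (hadjoint s) \<Omega>))"
      using trace[OF N'(7)[OF that(1,2)]] that N' by (simp add: hadjoint_compose)
    also have "\<dots> \<le> norm (hadjoint t) * norm (blinfun_apply (hadjoint s) \<Omega>)"
      by (rule norm_blinfun)
    also have "\<dots> \<le> 1 * norm (blinfun_apply (hadjoint s) \<Omega>)"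
      using that N' by (intro mult_right_mono) auto
    finally show ?thesis
      using trace that by simp
  qed
  have B: "norm B \<le> 1" "norm w \<le> 1" "w = 2 *\<^sub>R (B o\<^sub>L y)"
    and BB: "B o\<^sub>L (id_blinfun + (y o\<^sub>L hadjoint y)) = id_blinfun"
    using w by (auto simp: is_transform_def)
  have Bv: "blinfun_apply B v + blinfun_apply B (blinfun_apply y (blinfun_apply (hadjoint y) v)) = v" for v
    using arg_cong[OF BB, of "\<lambda>T. blinfun_apply T v"] by (simp add: blinfun.bilinear_simps)
  have Cv: "v = blinfun_apply C v + blinfun_apply (hadjoint z) (blinfun_apply z (blinfun_apply C v))" for v
    using arg_cong[OF C(3), of "\<lambda>T. blinfun_apply T v"] by (simp add: blinfun.add_left)
  have zy: "hadjoint (z - y) = hadjoint z - hadjoint y"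
    using N' y z by (simp add: hadjoint_diff)
  have "w - x = 2 *\<^sub>R (B o\<^sub>L ((y - z) o\<^sub>L C)) + (1/2) *\<^sub>R (w o\<^sub>L (hadjoint (z - y) o\<^sub>L x))"
  proof (rule blinfun_eqI)
    fix v
    define q where "q = blinfun_apply C v"
    \<comment> \<open>The two expansions insert \<open>(1 + z^* z) C\<close> to the right of
      \<open>B y\<close> and \<open>B (y y^* + 1)\<close> to the left of \<open>z\<close>. Their
      terms pair up into \<open>y - z\<close> and the adjoint of \<open>z - y\<close>.\<close>
    have 1: "blinfun_apply B (blinfun_apply y v) = blinfun_apply B (blinfun_apply y q) +
        blinfun_apply B (blinfun_apply y (blinfun_apply (hadjoint z) (blinfun_apply z q)))"
      by (subst Cv[of v]) (simp add: q_def blinfun.add_right)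
    have 2: "blinfun_apply z q = blinfun_apply B (blinfun_apply z q) +
        blinfun_apply B (blinfun_apply y (blinfun_apply (hadjoint y) (blinfun_apply z q)))"
      using Bv[of "blinfun_apply z q"] by simp
    have "blinfun_apply (w - x) v = 2 *\<^sub>R (blinfun_apply B (blinfun_apply y v) - blinfun_apply z q)"
      by (simp add: B x q_def blinfun.bilinear_simps scaleR_diff_right)
    also have "blinfun_apply B (blinfun_apply y v) - blinfun_apply z q =
        blinfun_apply B (blinfun_apply (y - z) q) +
        blinfun_apply B (blinfun_apply y (blinfun_apply (hadjoint (z - y)) (blinfun_apply z q)))"
      unfolding 1 by (subst 2) (simp add: zy blinfun.bilinear_simps)
    finally show "blinfun_apply (w - x) v =
        blinfun_apply (2 *\<^sub>R (B o\<^sub>L ((y - z) o\<^sub>L C)) + (1/2) *\<^sub>R (w o\<^sub>L (hadjoint (z - y) o\<^sub>L x))) v"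
      by (simp add: B x q_def[symmetric] blinfun.scaleR_left blinfun.scaleR_right blinfun.add_left
          scaleR_add_right)
  qed
  from arg_cong[OF this, of "\<lambda>T. blinfun_apply T \<Omega>"]
  have "blinfun_apply w \<Omega> - blinfun_apply x \<Omega> =
      2 *\<^sub>R blinfun_apply B (blinfun_apply (y - z) (blinfun_apply C \<Omega>)) +
      (1/2) *\<^sub>R blinfun_apply w (blinfun_apply (hadjoint (z - y)) (blinfun_apply x \<Omega>))"
    by (simp add: blinfun.add_left blinfun.diff_left blinfun.scaleR_left)
  also have "norm \<dots> \<le> 2 * norm (blinfun_apply (y - z) \<Omega>) + (1/2) * norm (blinfun_apply (y - z) \<Omega>)"
  proof (rule norm_triangle_mono)
    have "norm (blinfun_apply B (blinfun_apply (y - z) (blinfun_apply C \<Omega>))) \<le>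
        norm B * norm (blinfun_apply (y - z) (blinfun_apply C \<Omega>))"
      by (rule norm_blinfun)
    also have "\<dots> \<le> 1 * norm (blinfun_apply (y - z) \<Omega>)"
      using B C N' y z by (intro mult_mono right_contraction) auto
    finally show "norm (2 *\<^sub>R blinfun_apply B (blinfun_apply (y - z) (blinfun_apply C \<Omega>))) \<le>
        2 * norm (blinfun_apply (y - z) \<Omega>)"
      by simp
    have "norm (blinfun_apply w (blinfun_apply (hadjoint (z - y)) (blinfun_apply x \<Omega>))) \<le>
        norm w * norm (blinfun_apply (hadjoint (z - y)) (blinfun_apply x \<Omega>))"
      by (rule norm_blinfun)
    also have "\<dots> \<le> 1 * norm (blinfun_apply (hadjoint (z - y)) \<Omega>)"
      using B x N' y z by (intro mult_mono right_contraction) auto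
    also have "norm (blinfun_apply (hadjoint (z - y)) \<Omega>) = norm (blinfun_apply (y - z) \<Omega>)"
      using trace[of "z - y"] N' y z by (simp add: blinfun.diff_left norm_minus_commute)
    finally show "norm ((1/2) *\<^sub>R blinfun_apply w (blinfun_apply (hadjoint (z - y)) (blinfun_apply x \<Omega>))) \<le>
        (1/2) * norm (blinfun_apply (y - z) \<Omega>)"
      by simp
  qed
  \<comment> \<open>The sum \<open>2 + 1/2\<close> is rounded up to 3.\<close>
  finally show ?thesis
    using norm_ge_zero[of "blinfun_apply y \<Omega> - blinfun_apply z \<Omega>"]
    unfolding blinfun.diff_left by linarith
qed

text \<open>Quantifying over all transforms of \<open>y\<close> leaves the ambient algebra to the
  caller: the norm closure of \<open>A\<close> for density, the image of \<open>M\<close> for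
  lifting. This is possible because \<open>B\<close> and \<open>w\<close> act on the left in the
  estimate, where their operator norms suffice.\<close>

lemma bicommutant_transform_approximation:
  assumes A: "star_subalgebra A" and one: "id_blinfun \<in> A"
    and trace: "\<And>s. s \<in> commutant (commutant A) \<Longrightarrow>
      norm (blinfun_apply (hadjoint s) \<Omega>) = norm (blinfun_apply s \<Omega>)"
    and T: "T \<in> commutant (commutant A)" "norm T < 1" and "e > 0"
  shows "\<exists>y\<in>A. \<forall>B w. is_transform y B w \<longrightarrow> norm (blinfun_apply w \<Omega> - blinfun_apply T \<Omega>) < e"
proof -
  let ?N = "commutant (commutant A)"
  note N = star_subalgebra_bicommutant[OF A]
  note N' = star_subalgebraD[OF N]
  obtain z where z: "z \<in> ?N" "2 *\<^sub>R z = T o\<^sub>L (id_blinfun + (hadjoint z o\<^sub>L z))"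
    using exists_transform_preimage[OF N closed_commutant id_in_commutant T] by blast
  obtain C where C: "C \<in> ?N" "norm C \<le> 1" "(id_blinfun + (hadjoint z o\<^sub>L z)) o\<^sub>L C = id_blinfun"
    using exists_inverse_id_plus_square[OF N id_in_commutant z(1)]
    unfolding closure_closed[OF closed_commutant] by blast
  have T_eq: "T = 2 *\<^sub>R (z o\<^sub>L C)"
  proof (rule blinfun_eqI)
    fix v
    have "blinfun_apply T v = blinfun_apply (T o\<^sub>L ((id_blinfun + (hadjoint z o\<^sub>L z)) o\<^sub>L C)) v"
      unfolding C by simp
    also have "\<dots> = blinfun_apply (2 *\<^sub>R z) (blinfun_apply C v)"
      unfolding z(2) by simp
    finally show "blinfun_apply T v = blinfun_apply (2 *\<^sub>R (z o\<^sub>L C)) v"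
      by (simp add: blinfun.scaleR_left)
  qed
  obtain y where y: "y \<in> A" "norm (blinfun_apply y \<Omega> - blinfun_apply z \<Omega>) < e / 3"
    using bicommutant_apply_in_closure[OF A one z(1), of \<Omega>] \<open>e > 0\<close>
    unfolding closure_approachable dist_norm by (auto dest: spec[of _ "e / 3"])
  have "y \<in> ?N"
    using y subset_bicommutant[OF star_subalgebraD(1)[OF A]] by blast
  then have "norm (blinfun_apply w \<Omega> - blinfun_apply T \<Omega>) < e" if "is_transform y B w" for B w
    using transform_trace_vector_estimate[OF N trace that _ z(1) C T(1) _ T_eq] y T by simp
  with y show ?thesis by blast
qed

section \<open>The standard representation of a tracial von Neumann algebra\<close>

locale tracial_L2 =
  fixes M :: "('k::complex_hilbert \<Rightarrow>\<^sub>L 'k) set"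
    and \<tau> :: "('k \<Rightarrow>\<^sub>L 'k) \<Rightarrow> complex"
    and \<Lambda> :: "('k \<Rightarrow>\<^sub>L 'k) \<Rightarrow> 'h::complex_hilbert"
  assumes vN: "von_neumann_algebra M" and state: "state_on M \<tau>" and faithful: "faithful_on M \<tau>"
    and normal: "normal_on M \<tau>" and tracial: "tracial_on M \<tau>" and L2: "is_L2 M \<tau> \<Lambda>"
begin

abbreviation L where "L \<equiv> left_mult M \<Lambda>"

abbreviation \<Omega> where "\<Omega> \<equiv> \<Lambda> id_blinfun"

text \<open>The working domain as long as bicommutants of subalgebras are not yet known to lie in
  the image of \<open>M\<close>; it contains all of them.\<close>

abbreviation N where "N \<equiv> commutant (commutant (L ` M))"

lemma star_subalgebra_M: "star_subalgebra M"
  using vN by (simp add: von_neumann_algebra_def)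

lemmas M = star_subalgebraD[OF star_subalgebra_M]

lemma bicommutant_M: "commutant (commutant M) = M"
  using vN by (simp add: von_neumann_algebra_def)

lemma closed_M: "closed M"
  using closed_commutant[of "commutant M"] by (simp add: bicommutant_M)

lemma id_in_M [simp]: "id_blinfun \<in> M"
  using id_in_commutant[of "commutant M"] by (simp add: bicommutant_M)

lemma Lambda_add: "x \<in> M \<Longrightarrow> y \<in> M \<Longrightarrow> \<Lambda> (x + y) = \<Lambda> x + \<Lambda> y"
  and Lambda_scaleC: "x \<in> M \<Longrightarrow> \<Lambda> (c *\<^sub>C x) = c *\<^sub>C \<Lambda> x"
  and Lambda_inner: "x \<in> M \<Longrightarrow> y \<in> M \<Longrightarrow> cinner (\<Lambda> x) (\<Lambda> y) = \<tau> (hadjoint y o\<^sub>L x)"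
  and Lambda_dense: "closure (\<Lambda> ` M) = UNIV"
  using L2 by (auto simp: is_L2_def)

lemma Lambda_diff:
  assumes "x \<in> M" "y \<in> M" shows "\<Lambda> (x - y) = \<Lambda> x - \<Lambda> y"
  using Lambda_add[OF M(4)[OF assms] assms(2)] by simp

lemma trace_commute: "x \<in> M \<Longrightarrow> y \<in> M \<Longrightarrow> \<tau> (x o\<^sub>L y) = \<tau> (y o\<^sub>L x)"
  using tracial by (simp add: tracial_on_def)

lemma Lambda_inner_compose_left:
  assumes "x \<in> M" "y \<in> M" "z \<in> M"
  shows "cinner (\<Lambda> (x o\<^sub>L y)) (\<Lambda> z) = cinner (\<Lambda> y) (\<Lambda> (hadjoint x o\<^sub>L z))"
  using assms M by (simp add: Lambda_inner hadjoint_compose blinfun_compose_assoc)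

lemma Lambda_eq_0D: "x \<in> M \<Longrightarrow> \<Lambda> x = 0 \<Longrightarrow> x = 0"
  using faithful Lambda_inner[of x x] by (simp add: faithful_on_def)

lemma power2_norm_Lambda: "x \<in> M \<Longrightarrow> (norm (\<Lambda> x))\<^sup>2 = Re (\<tau> (hadjoint x o\<^sub>L x))"
  using arg_cong[OF Lambda_inner[of x x], of Re] by (simp add: cinner_self)

lemma norm_Lambda_hadjoint:
  assumes "x \<in> M" shows "norm (\<Lambda> (hadjoint x)) = norm (\<Lambda> x)"
proof -
  have "(norm (\<Lambda> (hadjoint x)))\<^sup>2 = (norm (\<Lambda> x))\<^sup>2"
    using assms M trace_commute[of x "hadjoint x"] by (simp add: power2_norm_Lambda)
  then show ?thesis
    by simp
qed

text \<open>For \<open>r > norm x\<close> write \<open>1 - x^* x / r^2 = c^* c\<close> with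
  \<open>c\<close> in \<open>M\<close>. Then the square of \<open>norm (\<Lambda> (c y))\<close> is
  that of \<open>norm (\<Lambda> y)\<close> minus \<open>1 / r^2\<close> times that of
  \<open>norm (\<Lambda> (x y))\<close>, and it is nonnegative. The root needs strict inequality, so
  \<open>r\<close> tends to \<open>norm x\<close> only at the end.\<close>

lemma norm_Lambda_compose_left:
  assumes x: "x \<in> M" and y: "y \<in> M"
  shows "norm (\<Lambda> (x o\<^sub>L y)) \<le> norm x * norm (\<Lambda> y)"
proof -
  have le: "norm (\<Lambda> (x o\<^sub>L y)) \<le> r * norm (\<Lambda> y)" if r: "norm x < r" for r
  proof -
    have "r > 0"
      using r norm_ge_zero[of x] by linarith
    define s where "s = 1 / r\<^sup>2"
    define a where "a = complex_of_real s *\<^sub>C (hadjoint x o\<^sub>L x)"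
    have s: "s > 0" "s * r\<^sup>2 = 1"
      using \<open>r > 0\<close> by (auto simp: s_def)
    have a: "a \<in> M"
      unfolding a_def by (intro M(5,7,8) x)
    have "norm (hadjoint x o\<^sub>L x) \<le> norm x * norm x"
      using norm_blinfun_compose[of "hadjoint x" x] x M by simp
    also have "\<dots> < r * r"
      using r by (intro mult_strict_mono') auto
    finally have "s * norm (hadjoint x o\<^sub>L x) < s * (r * r)"
      using s(1) by (rule mult_strict_left_mono)
    also have "\<dots> = 1"
      using s(2) by (simp add: power2_eq_square)
    finally have "norm a < 1"
      using s by (simp add: a_def flip: scaleR_blinfun_scaleC)
    moreover have "hadjoint a = a"
      using x M by (simp add: a_def hadjoint_scaleC hadjoint_compose)
    ultimately obtain c where c: "c \<in> M" "id_blinfun - a = hadjoint c o\<^sub>L c"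
      using exists_sqrt_id_minus[OF star_subalgebra_M closed_M id_in_M a] by blast
    have "hadjoint c o\<^sub>L (c o\<^sub>L y) = y - (a o\<^sub>L y)"
      unfolding blinfun_compose_assoc[symmetric] c(2)[symmetric]
      by (rule blinfun_eqI) (simp add: blinfun.bilinear_simps)
    moreover have "a o\<^sub>L y = complex_of_real s *\<^sub>C (hadjoint x o\<^sub>L (x o\<^sub>L y))"
      by (rule blinfun_eqI) (simp add: a_def scaleC_blinfun_apply)
    ultimately have eq: "hadjoint c o\<^sub>L (c o\<^sub>L y) = y - complex_of_real s *\<^sub>C (hadjoint x o\<^sub>L (x o\<^sub>L y))"
      by simp
    have "of_real ((norm (\<Lambda> (c o\<^sub>L y)))\<^sup>2) = cinner (\<Lambda> y) (\<Lambda> (hadjoint c o\<^sub>L (c o\<^sub>L y)))"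
      using Lambda_inner_compose_left[OF c(1) y, of "c o\<^sub>L y"] c y M by (simp add: cinner_self)
    also have "\<dots> = cinner (\<Lambda> y) (\<Lambda> y) -
        of_real s * cinner (\<Lambda> y) (\<Lambda> (hadjoint x o\<^sub>L (x o\<^sub>L y)))"
      unfolding eq using x y M
      by (simp add: Lambda_diff Lambda_scaleC cinner_diff_right cinner_scaleC_right)
    also have "cinner (\<Lambda> y) (\<Lambda> (hadjoint x o\<^sub>L (x o\<^sub>L y))) = of_real ((norm (\<Lambda> (x o\<^sub>L y)))\<^sup>2)"
      using Lambda_inner_compose_left[OF x y, of "x o\<^sub>L y"] x y M by (simp add: cinner_self)
    finally have "(norm (\<Lambda> (c o\<^sub>L y)))\<^sup>2 = (norm (\<Lambda> y))\<^sup>2 - s * (norm (\<Lambda> (x o\<^sub>L y)))\<^sup>2"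
      unfolding cinner_self of_real_mult[symmetric] of_real_diff[symmetric] of_real_eq_iff .
    then have "s * (norm (\<Lambda> (x o\<^sub>L y)))\<^sup>2 \<le> (norm (\<Lambda> y))\<^sup>2"
      using zero_le_power2[of "norm (\<Lambda> (c o\<^sub>L y))"] by linarith
    then have "(norm (\<Lambda> (x o\<^sub>L y)))\<^sup>2 \<le> (r * norm (\<Lambda> y))\<^sup>2"
      using \<open>r > 0\<close> by (simp add: s_def power_mult_distrib divide_simps mult.commute)
    then show ?thesis
      by (rule power2_le_imp_le) (use \<open>r > 0\<close> in simp)
  qed
  have "((\<lambda>n. (norm x + inverse (real (Suc n))) * norm (\<Lambda> y)) \<longlongrightarrow> (norm x + 0) * norm (\<Lambda> y)) sequentially"
    by (intro tendsto_intros LIMSEQ_inverse_real_of_nat)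
  then have "norm (\<Lambda> (x o\<^sub>L y)) \<le> (norm x + 0) * norm (\<Lambda> y)"
    by (rule LIMSEQ_le_const) (use le in auto)
  then show ?thesis by simp
qed

text \<open>Adjoints reverse the product and, by traciality, preserve the norm of \<Lambda>-values;
  this reduces right multiplication to left multiplication.\<close>

lemma norm_Lambda_compose_right:
  assumes "x \<in> M" "y \<in> M"
  shows "norm (\<Lambda> (x o\<^sub>L y)) \<le> norm y * norm (\<Lambda> x)"
proof -
  have "norm (\<Lambda> (x o\<^sub>L y)) = norm (\<Lambda> (hadjoint y o\<^sub>L hadjoint x))"
    using norm_Lambda_hadjoint[of "x o\<^sub>L y"] assms M by (simp add: hadjoint_compose)
  also have "\<dots> \<le> norm (hadjoint y) * norm (\<Lambda> (hadjoint x))"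
    by (intro norm_Lambda_compose_left M assms)
  finally show ?thesis
    using assms M norm_Lambda_hadjoint by simp
qed

section \<open>Extension from the dense image of \<Lambda>; left and right multiplication
  operators\<close>

lemma blinfun_eq_on_LambdaI:
  fixes S T :: "'h \<Rightarrow>\<^sub>L 'h"
  assumes "\<And>y. y \<in> M \<Longrightarrow> blinfun_apply S (\<Lambda> y) = blinfun_apply T (\<Lambda> y)"
  shows "S = T"
proof (rule blinfun_eqI)
  have "closure (\<Lambda> ` M) \<subseteq> {v. blinfun_apply S v = blinfun_apply T v}"
    using assms by (intro closure_minimal closed_Collect_eq continuous_intros) auto
  then show "blinfun_apply S v = blinfun_apply T v" for v
    by (auto simp: Lambda_dense)
qed

text \<open>Used for left and right multiplication. Linearity and the norm bound are closed
  conditions, so they pass from the dense image to the whole space; additivity uses density of the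
  product of two copies.\<close>

lemma exists_extension:
  fixes f :: "('k \<Rightarrow>\<^sub>L 'k) \<Rightarrow> 'h"
  assumes add: "\<And>x y. x \<in> M \<Longrightarrow> y \<in> M \<Longrightarrow> f (x + y) = f x + f y"
    and scale: "\<And>c x. x \<in> M \<Longrightarrow> f (c *\<^sub>C x) = c *\<^sub>C f x"
    and bound: "\<And>x. x \<in> M \<Longrightarrow> norm (f x) \<le> K * norm (\<Lambda> x)" and "0 \<le> K"
  shows "\<exists>T\<in>bounded_ops. norm T \<le> K \<and> (\<forall>x\<in>M. blinfun_apply T (\<Lambda> x) = f x)"
proof -
  have f_diff: "f (x - y) = f x - f y" if "x \<in> M" "y \<in> M" for x y
    using add[OF M(4)[OF that] that(2)] by simp
  have lip: "norm (f x - f y) \<le> K * norm (\<Lambda> x - \<Lambda> y)" if "x \<in> M" "y \<in> M" for x y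
    using bound[OF M(4)[OF that]] that by (simp add: f_diff Lambda_diff)
  \<comment> \<open>The chosen preimage is immaterial: by \<open>lip\<close>, equal values of
    \<Lambda> have equal values of \<open>f\<close>.\<close>
  define g0 where "g0 v = f (inv_into M \<Lambda> v)" for v
  have g0: "g0 (\<Lambda> x) = f x" if "x \<in> M" for x
    using lip[of "inv_into M \<Lambda> (\<Lambda> x)" x] that
    by (simp add: g0_def f_inv_into_f inv_into_into)
  have "K-lipschitz_on (\<Lambda> ` M) g0"
    using \<open>0 \<le> K\<close> by (intro lipschitz_onI) (auto simp: g0 dist_norm lip)
  then have "uniformly_continuous_on (\<Lambda> ` M) g0"
    by (rule lipschitz_on_uniformly_continuous)
  then obtain g where "uniformly_continuous_on (closure (\<Lambda> ` M)) g"
      "\<And>v. v \<in> \<Lambda> ` M \<Longrightarrow> g0 v = g v"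
    by (rule uniformly_continuous_on_extension_on_closure) iprover
  then have g: "uniformly_continuous_on UNIV g" "\<And>v. v \<in> \<Lambda> ` M \<Longrightarrow> g0 v = g v"
    by (auto simp: Lambda_dense)
  have g_Lambda: "g (\<Lambda> x) = f x" if "x \<in> M" for x
    using g(2)[of "\<Lambda> x"] g0 that by simp
  have g_cont: "continuous_on UNIV g"
    using g(1) by (rule uniformly_continuous_imp_continuous)
  have g_comp: "continuous_on UNIV (\<lambda>x. g (h x))" if "continuous_on UNIV h" for h :: "'b::topological_space \<Rightarrow> 'h"
    by (rule continuous_on_compose2[OF g_cont that]) simp
  have "closure (\<Lambda> ` M) \<subseteq> {v. norm (g v) \<le> K * norm v}"
    using bound by (intro closure_minimal closed_Collect_le continuous_intros g_comp) (auto simp: g_Lambda)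
  then have g_norm: "norm (g v) \<le> K * norm v" for v
    by (auto simp: Lambda_dense)
  have "closure (\<Lambda> ` M) \<subseteq> {v. g (c *\<^sub>C v) = c *\<^sub>C g v}" for c
    using M(5) by (intro closure_minimal closed_Collect_eq continuous_intros g_comp)
      (auto simp: g_Lambda scale simp flip: Lambda_scaleC)
  then have g_scale: "g (c *\<^sub>C v) = c *\<^sub>C g v" for c v
    by (auto simp: Lambda_dense)
  have "closure (\<Lambda> ` M \<times> \<Lambda> ` M) \<subseteq> {p. g (fst p + snd p) = g (fst p) + g (snd p)}"
    using M(3) by (intro closure_minimal closed_Collect_eq continuous_intros g_comp)
      (auto simp: g_Lambda add simp flip: Lambda_add)
  then have g_add: "g (u + v) = g u + g v" for u v
    by (auto simp: closure_Times Lambda_dense dest: subsetD[of _ _ "(u, v)"])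
  have "bounded_linear g"
    by (rule bounded_linear_intro[of _ K])
      (auto simp: g_add g_scale scaleR_scaleC g_norm mult.commute)
  then have ap: "blinfun_apply (Blinfun g) = g"
    by (rule bounded_linear_Blinfun_apply)
  have "norm (Blinfun g) \<le> K"
    using \<open>0 \<le> K\<close> g_norm by (intro norm_blinfun_bound) (auto simp: ap)
  then show ?thesis
    using g_scale g_Lambda by (intro bexI[of _ "Blinfun g"]) (auto simp: bounded_ops_def ap)
qed

lemma left_mult_exists:
  assumes x: "x \<in> M"
  shows "L x \<in> bounded_ops \<and> norm (L x) \<le> norm x \<and> (\<forall>y\<in>M. blinfun_apply (L x) (\<Lambda> y) = \<Lambda> (x o\<^sub>L y))"
proof -
  have "\<exists>T\<in>bounded_ops. norm T \<le> norm x \<and> (\<forall>y\<in>M. blinfun_apply T (\<Lambda> y) = \<Lambda> (x o\<^sub>L y))"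
  proof (rule exists_extension)
    fix y z c assume y: "y \<in> M"
    show "norm (\<Lambda> (x o\<^sub>L y)) \<le> norm x * norm (\<Lambda> y)"
      using x y by (rule norm_Lambda_compose_left)
    have "x o\<^sub>L (c *\<^sub>C y) = c *\<^sub>C (x o\<^sub>L y)"
      using M(9)[OF x] by (intro blinfun_eqI) (simp add: scaleC_blinfun_apply bounded_opsD)
    then show "\<Lambda> (x o\<^sub>L (c *\<^sub>C y)) = c *\<^sub>C \<Lambda> (x o\<^sub>L y)"
      using x y M by (simp add: Lambda_scaleC)
    assume z: "z \<in> M"
    have "x o\<^sub>L (y + z) = (x o\<^sub>L y) + (x o\<^sub>L z)"
      by (intro blinfun_eqI) (simp add: blinfun.bilinear_simps)
    then show "\<Lambda> (x o\<^sub>L (y + z)) = \<Lambda> (x o\<^sub>L y) + \<Lambda> (x o\<^sub>L z)"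
      using x y z M by (simp add: Lambda_add)
  qed simp
  then obtain T where T: "T \<in> bounded_ops" "norm T \<le> norm x"
      "\<forall>y\<in>M. blinfun_apply T (\<Lambda> y) = \<Lambda> (x o\<^sub>L y)" by blast
  have "L x = T"
    unfolding left_mult_def using T(3)
    by (intro the_equality blinfun_eq_on_LambdaI) auto
  with T show ?thesis by blast
qed

lemma left_mult_Lambda: "x \<in> M \<Longrightarrow> y \<in> M \<Longrightarrow> blinfun_apply (L x) (\<Lambda> y) = \<Lambda> (x o\<^sub>L y)"
  and left_mult_bounded_ops: "x \<in> M \<Longrightarrow> L x \<in> bounded_ops"
  and norm_left_mult: "x \<in> M \<Longrightarrow> norm (L x) \<le> norm x"
  using left_mult_exists by auto

lemma left_mult_Omega: "x \<in> M \<Longrightarrow> blinfun_apply (L x) \<Omega> = \<Lambda> x"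
  by (simp add: left_mult_Lambda)

text \<open>These operators are the supply of elements of the commutant; they carry
  \<open>\<Omega>\<close> to every \<open>\<Lambda> y\<close>.\<close>

lemma right_mult_exists:
  assumes y: "y \<in> M"
  shows "\<exists>R\<in>commutant (L ` M). \<forall>x\<in>M. blinfun_apply R (\<Lambda> x) = \<Lambda> (x o\<^sub>L y)"
proof -
  have "\<exists>T\<in>bounded_ops. norm T \<le> norm y \<and> (\<forall>x\<in>M. blinfun_apply T (\<Lambda> x) = \<Lambda> (x o\<^sub>L y))"
  proof (rule exists_extension)
    fix x z c assume x: "x \<in> M"
    show "norm (\<Lambda> (x o\<^sub>L y)) \<le> norm y * norm (\<Lambda> x)"
      using x y by (rule norm_Lambda_compose_right)
    have "(c *\<^sub>C x) o\<^sub>L y = c *\<^sub>C (x o\<^sub>L y)"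
      by (intro blinfun_eqI) (simp add: scaleC_blinfun_apply)
    then show "\<Lambda> ((c *\<^sub>C x) o\<^sub>L y) = c *\<^sub>C \<Lambda> (x o\<^sub>L y)"
      using x y M by (simp add: Lambda_scaleC)
    assume z: "z \<in> M"
    have "(x + z) o\<^sub>L y = (x o\<^sub>L y) + (z o\<^sub>L y)"
      by (intro blinfun_eqI) (simp add: blinfun.bilinear_simps)
    then show "\<Lambda> ((x + z) o\<^sub>L y) = \<Lambda> (x o\<^sub>L y) + \<Lambda> (z o\<^sub>L y)"
      using x y z M by (simp add: Lambda_add)
  qed simp
  then obtain R where R: "R \<in> bounded_ops" "\<And>x. x \<in> M \<Longrightarrow> blinfun_apply R (\<Lambda> x) = \<Lambda> (x o\<^sub>L y)"
    by blast
  have "R o\<^sub>L L x = L x o\<^sub>L R" if "x \<in> M" for x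
    using that y M by (intro blinfun_eq_on_LambdaI) (simp add: R left_mult_Lambda blinfun_compose_assoc)
  then have "R \<in> commutant (L ` M)"
    using R(1) by (auto simp: commutant_def)
  with R show ?thesis by blast
qed

lemma left_mult_compose: "x \<in> M \<Longrightarrow> y \<in> M \<Longrightarrow> L (x o\<^sub>L y) = L x o\<^sub>L L y"
  using M by (intro blinfun_eq_on_LambdaI) (simp add: left_mult_Lambda blinfun_compose_assoc)

lemma left_mult_add: "x \<in> M \<Longrightarrow> y \<in> M \<Longrightarrow> L (x + y) = L x + L y"
  using M by (intro blinfun_eq_on_LambdaI)
    (simp add: left_mult_Lambda blinfun.add_left bounded_bilinear.add_left[OF bounded_bilinear_blinfun_compose] Lambda_add)

lemma left_mult_scaleC:
  assumes "x \<in> M" shows "L (c *\<^sub>C x) = c *\<^sub>C L x"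
proof (rule blinfun_eq_on_LambdaI)
  fix y assume "y \<in> M"
  moreover have "(c *\<^sub>C x) o\<^sub>L y = c *\<^sub>C (x o\<^sub>L y)"
    by (intro blinfun_eqI) (simp add: scaleC_blinfun_apply)
  ultimately show "blinfun_apply (L (c *\<^sub>C x)) (\<Lambda> y) = blinfun_apply (c *\<^sub>C L x) (\<Lambda> y)"
    using assms M by (simp add: left_mult_Lambda scaleC_blinfun_apply Lambda_scaleC)
qed

lemma left_mult_id: "L id_blinfun = id_blinfun"
  using M by (intro blinfun_eq_on_LambdaI) (simp add: left_mult_Lambda)

lemma left_mult_hadjoint:
  assumes x: "x \<in> M" shows "L (hadjoint x) = hadjoint (L x)"
proof (rule blinfun_eq_on_LambdaI)
  fix y assume y: "y \<in> M"
  show "blinfun_apply (L (hadjoint x)) (\<Lambda> y) = blinfun_apply (hadjoint (L x)) (\<Lambda> y)"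
  proof (rule cinner_right_eqI)
    fix v
    have "closure (\<Lambda> ` M) \<subseteq> {v. cinner v (blinfun_apply (L (hadjoint x)) (\<Lambda> y)) =
        cinner v (blinfun_apply (hadjoint (L x)) (\<Lambda> y))}"
      using x y M by (intro closure_minimal closed_Collect_eq continuous_intros)
        (auto simp: left_mult_Lambda cinner_hadjoint left_mult_bounded_ops Lambda_inner_compose_left)
    then show "cinner v (blinfun_apply (L (hadjoint x)) (\<Lambda> y)) =
        cinner v (blinfun_apply (hadjoint (L x)) (\<Lambda> y))"
      by (auto simp: Lambda_dense)
  qed
qed

lemma star_subalgebra_left_mult: "star_subalgebra (L ` M)"
  unfolding star_subalgebra_def
proof (intro conjI ballI allI)
  show "0 \<in> L ` M"
  proof (rule rev_image_eqI[OF M(2)])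
    show "0 = L 0"
      using left_mult_add[OF M(2) M(2)] by simp
  qed
qed (use M in \<open>auto simp: left_mult_bounded_ops simp flip: left_mult_add left_mult_scaleC left_mult_compose
    left_mult_hadjoint\<close>)

lemma left_mult_in_N: "x \<in> M \<Longrightarrow> L x \<in> N"
  using subset_bicommutant[OF star_subalgebraD(1)[OF star_subalgebra_left_mult]] by blast

text \<open>\<open>\<Omega>\<close> is cyclic for the right multiplications, hence separating for
  whatever commutes with them.\<close>

lemma N_eqI:
  assumes S: "S \<in> N" and T: "T \<in> N" and eq: "blinfun_apply S \<Omega> = blinfun_apply T \<Omega>"
  shows "S = T"
proof (rule blinfun_eq_on_LambdaI)
  fix y assume y: "y \<in> M"
  obtain R where R: "R \<in> commutant (L ` M)" "\<And>x. x \<in> M \<Longrightarrow> blinfun_apply R (\<Lambda> x) = \<Lambda> (x o\<^sub>L y)"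
    using right_mult_exists[OF y] by blast
  have "\<Lambda> y = blinfun_apply R \<Omega>"
    by (simp add: R)
  then show "blinfun_apply S (\<Lambda> y) = blinfun_apply T (\<Lambda> y)"
    using commutantD[OF S R(1), of \<Omega>] commutantD[OF T R(1), of \<Omega>] eq by simp
qed

text \<open>On \<open>M\<close> this is traciality. For general \<open>s\<close> approximate
  \<open>s \<Omega>\<close> by \<open>\<Lambda> (x n)\<close>; the vectors of the adjoints converge
  as well, since taking adjoints is isometric. Pairing with \<open>\<Lambda> y = R \<Omega>\<close>,
  for a right multiplication \<open>R\<close> commuting with \<open>s\<close>, identifies their
  limit as \<open>s^* \<Omega>\<close>.\<close>

lemma norm_hadjoint_Omega:
  assumes s: "s \<in> N"
  shows "norm (blinfun_apply (hadjoint s) \<Omega>) = norm (blinfun_apply s \<Omega>)"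
proof -
  have sb: "s \<in> bounded_ops"
    using s by (rule commutant_bounded_ops)
  have "blinfun_apply s \<Omega> \<in> closure (\<Lambda> ` M)"
    by (simp add: Lambda_dense)
  then obtain u where u: "\<And>n. u n \<in> \<Lambda> ` M" "u \<longlonglongrightarrow> blinfun_apply s \<Omega>"
    unfolding closure_sequential by blast
  define x where "x n = inv_into M \<Lambda> (u n)" for n
  have x: "x n \<in> M" and "\<Lambda> (x n) = u n" for n
    using u(1) by (auto simp: x_def inv_into_into f_inv_into_f)
  with u(2) have lim: "(\<lambda>n. \<Lambda> (x n)) \<longlonglongrightarrow> blinfun_apply s \<Omega>"
    by simp
  have diff: "norm (\<Lambda> (hadjoint (x m)) - \<Lambda> (hadjoint (x n))) = norm (\<Lambda> (x m) - \<Lambda> (x n))" for m n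
  proof -
    have "\<Lambda> (hadjoint (x m)) - \<Lambda> (hadjoint (x n)) = \<Lambda> (hadjoint (x m - x n))"
      using x M by (simp add: Lambda_diff hadjoint_diff)
    then show ?thesis
      using norm_Lambda_hadjoint[OF M(4)[OF x x, of m n]] x by (simp add: Lambda_diff)
  qed
  have "Cauchy (\<lambda>n. \<Lambda> (x n))"
    using lim by (rule LIMSEQ_imp_Cauchy)
  then have "Cauchy (\<lambda>n. \<Lambda> (hadjoint (x n)))"
    unfolding Cauchy_def dist_norm diff .
  then obtain v where v: "(\<lambda>n. \<Lambda> (hadjoint (x n))) \<longlonglongrightarrow> v"
    using Cauchy_convergent_iff convergent_def by blast
  have "norm v = norm (blinfun_apply s \<Omega>)"
  proof (rule LIMSEQ_unique)
    show "(\<lambda>n. norm (\<Lambda> (hadjoint (x n)))) \<longlonglongrightarrow> norm v"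
      by (intro tendsto_intros v)
    show "(\<lambda>n. norm (\<Lambda> (hadjoint (x n)))) \<longlonglongrightarrow> norm (blinfun_apply s \<Omega>)"
      unfolding norm_Lambda_hadjoint[OF x] by (intro tendsto_intros lim)
  qed
  moreover have "blinfun_apply (hadjoint s) \<Omega> = v"
  proof (rule cinner_left_eqI)
    fix w
    have *: "cinner (blinfun_apply (hadjoint s) \<Omega>) (\<Lambda> y) = cinner v (\<Lambda> y)" if y: "y \<in> M" for y
    proof (rule LIMSEQ_unique)
      obtain R where R: "R \<in> commutant (L ` M)" "\<And>x. x \<in> M \<Longrightarrow> blinfun_apply R (\<Lambda> x) = \<Lambda> (x o\<^sub>L y)"
        using right_mult_exists[OF y] by blast
      have "cinner (blinfun_apply (hadjoint s) \<Omega>) (\<Lambda> y) = cinner \<Omega> (blinfun_apply s (blinfun_apply R \<Omega>))"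
        using sb by (simp add: cinner_hadjoint_left R)
      also have "\<dots> = cinner \<Omega> (blinfun_apply R (blinfun_apply s \<Omega>))"
        using commutantD[OF s R(1)] by simp
      finally have eq: "cinner (blinfun_apply (hadjoint s) \<Omega>) (\<Lambda> y) = \<dots>" .
      have "cinner \<Omega> (blinfun_apply R (\<Lambda> (x n))) = cinner (\<Lambda> (hadjoint (x n))) (\<Lambda> y)" for n
        using x y M by (simp add: R Lambda_inner hadjoint_compose)
      moreover have "(\<lambda>n. cinner \<Omega> (blinfun_apply R (\<Lambda> (x n)))) \<longlonglongrightarrow>
          cinner (blinfun_apply (hadjoint s) \<Omega>) (\<Lambda> y)"
        unfolding eq by (intro tendsto_intros lim)
      ultimately show "(\<lambda>n. cinner (\<Lambda> (hadjoint (x n))) (\<Lambda> y)) \<longlonglongrightarrow>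
          cinner (blinfun_apply (hadjoint s) \<Omega>) (\<Lambda> y)"
        by simp
      show "(\<lambda>n. cinner (\<Lambda> (hadjoint (x n))) (\<Lambda> y)) \<longlonglongrightarrow> cinner v (\<Lambda> y)"
        by (intro tendsto_intros v)
    qed
    have "closure (\<Lambda> ` M) \<subseteq> {w. cinner (blinfun_apply (hadjoint s) \<Omega>) w = cinner v w}"
      using * by (intro closure_minimal closed_Collect_eq continuous_intros) auto
    then show "cinner (blinfun_apply (hadjoint s) \<Omega>) w = cinner v w"
      by (auto simp: Lambda_dense)
  qed
  ultimately show ?thesis by simp
qed

end

section \<open>Weak compactness\<close>

lemma compact_Pi_UNIV:
  fixes S :: "'i \<Rightarrow> 'b::topological_space set"
  assumes "\<And>i. compact (S i)"
  shows "compact {f. \<forall>i. f i \<in> S i}"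
proof -
  have "compactin (product_topology (\<lambda>i. euclidean) UNIV) (PiE UNIV S)"
    unfolding compactin_PiE using assms by simp
  then show ?thesis
    unfolding euclidean_product_topology by (simp add: PiE_def Pi_def)
qed

text \<open>Instead of an ultrafilter limit we pass to the trace of the neighbourhood filter of a
  cluster point.\<close>

lemma exists_weak_cluster_operator:
  fixes b :: "nat \<Rightarrow> 'a::complex_hilbert \<Rightarrow>\<^sub>L 'a"
  assumes b: "\<And>n. b n \<in> bounded_ops" "\<And>n. norm (b n) \<le> 1"
  shows "\<exists>F T. F \<noteq> bot \<and> F \<le> sequentially \<and> T \<in> bounded_ops \<and>
    (\<forall>x y. ((\<lambda>n. cinner (blinfun_apply (b n) x) y) \<longlongrightarrow> cinner (blinfun_apply T x) y) F)"
proof -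
  define \<phi> where "\<phi> n = (\<lambda>(x, y). cinner (blinfun_apply (b n) x) y)" for n
  \<comment> \<open>The matrix coefficients of a contraction form a point of this product of discs,
    compact by Tychonoff's theorem.\<close>
  define K where "K = {f. \<forall>p. f p \<in> cball (0::complex) (norm (fst p :: 'a) * norm (snd p :: 'a))}"
  have bnd: "cmod (cinner (blinfun_apply (b n) x) y) \<le> norm x * norm y" for n x y
  proof -
    have "norm (blinfun_apply (b n) x) \<le> 1 * norm x"
      using norm_blinfun[of "b n" x] mult_right_mono[OF b(2)[of n], of "norm x"] by simp
    then have "norm (blinfun_apply (b n) x) * norm y \<le> norm x * norm y"
      by (intro mult_right_mono) auto
    with cinner_Cauchy_Schwarz[of "blinfun_apply (b n) x" y] show ?thesis
      by (rule order_trans)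
  qed
  have "compact K"
    unfolding K_def by (intro compact_Pi_UNIV) simp
  moreover have "filtermap \<phi> sequentially \<noteq> bot"
    by (simp add: filtermap_bot_iff)
  moreover have "eventually (\<lambda>f. f \<in> K) (filtermap \<phi> sequentially)"
    using bnd by (auto simp: eventually_filtermap K_def \<phi>_def)
  ultimately obtain f where f: "f \<in> K" "inf (nhds f) (filtermap \<phi> sequentially) \<noteq> bot"
    unfolding compact_filter by blast
  \<comment> \<open>A filter on the indices, along which all matrix coefficients converge
    simultaneously; it is proper because \<open>f\<close> is a cluster point.\<close>
  define F where "F = inf (filtercomap \<phi> (nhds f)) sequentially"
  have "F \<noteq> bot"
  proof
    assume "F = bot"
    then have "eventually (\<lambda>_. False) F"
      by simp
    then obtain P Q where PQ: "eventually P (filtercomap \<phi> (nhds f))" "eventually Q sequentially"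
        "\<And>n. P n \<and> Q n \<Longrightarrow> False"
      unfolding F_def eventually_inf by blast
    then obtain P' where P': "eventually P' (nhds f)" "\<And>n. P' (\<phi> n) \<Longrightarrow> P n"
      unfolding eventually_filtercomap by blast
    have "eventually (\<lambda>g. \<exists>n. Q n \<and> g = \<phi> n) (filtermap \<phi> sequentially)"
      unfolding eventually_filtermap using PQ(2) by (rule eventually_mono) blast
    with P'(1) have "eventually (\<lambda>_. False) (inf (nhds f) (filtermap \<phi> sequentially))"
      unfolding eventually_inf using PQ(3) P'(2) by blast
    with f(2) show False
      by (simp add: eventually_False)
  qed
  have "filterlim \<phi> (nhds f) F"
    unfolding F_def by (rule filterlim_mono[OF filterlim_filtercomap order_refl inf_le1])
  then have "((\<lambda>n. \<phi> n p) \<longlongrightarrow> f p) F" for p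
    by (rule continuous_on_tendsto_compose[OF continuous_on_product_coordinates]) auto
  from this[of "(x, y)" for x y]
  have lim: "((\<lambda>n. cinner (blinfun_apply (b n) x) y) \<longlongrightarrow> f (x, y)) F" for x y
    unfolding \<phi>_def by simp
  have "\<exists>T\<in>bounded_ops. norm T \<le> 1 \<and> (\<forall>x y. cinner (blinfun_apply T x) y = f (x, y))"
  proof (rule exists_operator_of_form)
    fix x y z :: 'a and c
    show "cmod (f (x, y)) \<le> 1 * (norm x * norm y)"
      using f(1) by (auto simp: K_def)
    show "f (x + y, z) = f (x, z) + f (y, z)"
      by (rule tendsto_unique[OF \<open>F \<noteq> bot\<close> lim])
        (simp add: blinfun.add_right cinner_add_left tendsto_add lim)
    show "f (x, y + z) = f (x, y) + f (x, z)"
      by (rule tendsto_unique[OF \<open>F \<noteq> bot\<close> lim])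
        (simp add: cinner_add_right tendsto_add lim)
    show "f (c *\<^sub>C x, y) = c * f (x, y)"
      by (rule tendsto_unique[OF \<open>F \<noteq> bot\<close> lim])
        (simp add: bounded_opsD[OF b(1)] cinner_scaleC_left tendsto_mult_left lim)
    show "f (x, c *\<^sub>C y) = cnj c * f (x, y)"
      by (rule tendsto_unique[OF \<open>F \<noteq> bot\<close> lim])
        (simp add: cinner_scaleC_right tendsto_mult_left lim)
  qed simp
  then obtain T where "T \<in> bounded_ops" "\<And>x y. cinner (blinfun_apply T x) y = f (x, y)"
    by blast
  with lim \<open>F \<noteq> bot\<close> show ?thesis
    by (intro exI[of _ F] exI[of _ T]) (simp add: F_def)
qed

text \<open>On norm-bounded sequences weak convergence is already ultraweak. For a subbasic set,
  Tannery's theorem exchanges limit and series, with a multiple of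
  \<open>norm (\<xi> k)^2 + norm (\<eta> k)^2\<close> as summable majorant.\<close>

lemma eventually_ultraweak_nbhd:
  fixes b :: "nat \<Rightarrow> 'a::complex_hilbert \<Rightarrow>\<^sub>L 'a"
  assumes bound: "\<And>n. norm (b n) \<le> K" and "F \<noteq> bot"
    and lim: "\<And>x y. ((\<lambda>n. cinner (blinfun_apply (b n) x) y) \<longlongrightarrow> cinner (blinfun_apply T x) y) F"
    and U: "openin ultraweak_topology U" "T \<in> U"
  shows "eventually (\<lambda>n. b n \<in> U) F"
proof -
  have "0 \<le> K"
    using bound[of 0] norm_ge_zero order_trans by blast
  have "T \<in> U \<longrightarrow> eventually (\<lambda>n. b n \<in> U) F"
    using openin_topology_generated_by[OF U(1)[unfolded ultraweak_topology_def]]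
  proof (induction rule: generate_topology_on.induct)
    case (Int U V)
    then show ?case by (auto intro: eventually_conj)
  next
    case (UN \<U>)
    show ?case
    proof
      assume "T \<in> \<Union>\<U>"
      then obtain V where V: "V \<in> \<U>" "T \<in> V" by blast
      then have "eventually (\<lambda>n. b n \<in> V) F"
        using UN by blast
      then show "eventually (\<lambda>n. b n \<in> \<Union>\<U>) F"
        by (rule eventually_mono) (use V in blast)
    qed
  next
    case (Basis V)
    then obtain \<xi> \<eta> :: "nat \<Rightarrow> 'a" and W where
      V: "V = {T. (\<Sum>n. cinner (blinfun_apply T (\<xi> n)) (\<eta> n)) \<in> W}" and "open W"
      and sum: "summable (\<lambda>n. (norm (\<xi> n))\<^sup>2)" "summable (\<lambda>n. (norm (\<eta> n))\<^sup>2)"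
      by blast
    have "cmod (cinner (blinfun_apply (b n) (\<xi> k)) (\<eta> k)) \<le> K * ((norm (\<xi> k))\<^sup>2 + (norm (\<eta> k))\<^sup>2)" for n k
    proof -
      have "cmod (cinner (blinfun_apply (b n) (\<xi> k)) (\<eta> k)) \<le> norm (blinfun_apply (b n) (\<xi> k)) * norm (\<eta> k)"
        by (rule cinner_Cauchy_Schwarz)
      also have "\<dots> \<le> (K * norm (\<xi> k)) * norm (\<eta> k)"
        using norm_blinfun[of "b n" "\<xi> k"] mult_right_mono[OF bound[of n], of "norm (\<xi> k)"]
        by (intro mult_right_mono) auto
      also have "\<dots> = K * (norm (\<xi> k) * norm (\<eta> k))"
        by simp
      also have "\<dots> \<le> K * ((norm (\<xi> k))\<^sup>2 + (norm (\<eta> k))\<^sup>2)"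
      proof (rule mult_left_mono[OF _ \<open>0 \<le> K\<close>])
        have "2 * (norm (\<xi> k) * norm (\<eta> k)) \<le> (norm (\<xi> k))\<^sup>2 + (norm (\<eta> k))\<^sup>2"
          using sum_squares_bound[of "norm (\<xi> k)" "norm (\<eta> k)"] by simp
        moreover have "0 \<le> norm (\<xi> k) * norm (\<eta> k)"
          by simp
        ultimately show "norm (\<xi> k) * norm (\<eta> k) \<le> (norm (\<xi> k))\<^sup>2 + (norm (\<eta> k))\<^sup>2"
          by linarith
      qed
      finally show ?thesis .
    qed
    then have "eventually (\<lambda>(k, n). cmod (cinner (blinfun_apply (b n) (\<xi> k)) (\<eta> k)) \<le>
        K * ((norm (\<xi> k))\<^sup>2 + (norm (\<eta> k))\<^sup>2)) (at_top \<times>\<^sub>F F)"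
      by (intro always_eventually) auto
    from tannerys_theorem[OF lim this summable_mult[OF summable_add[OF sum]] \<open>F \<noteq> bot\<close>]
    have "((\<lambda>n. \<Sum>k. cinner (blinfun_apply (b n) (\<xi> k)) (\<eta> k)) \<longlongrightarrow>
        (\<Sum>k. cinner (blinfun_apply T (\<xi> k)) (\<eta> k))) F"
      by blast
    then show ?case
      using \<open>open W\<close> unfolding V by (auto dest: topological_tendstoD)
  qed simp
  with U show ?thesis by blast
qed

section \<open>Bicommutants inside the image of \<open>M\<close>, and density of unit balls\<close>

context tracial_L2
begin

text \<open>A weak cluster point \<open>T\<close> of \<open>b\<close> lies in
  \<open>M'' = M\<close>. Normality makes \<open>\<tau> (y^* b n)\<close>, the inner product of
  \<open>\<Lambda> (b n)\<close> with \<open>\<Lambda> y\<close>, converge to the one for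
  \<open>T\<close>; hence \<open>\<Lambda> T\<close> agrees with the norm limit.\<close>

lemma bounded_Lambda_limit:
  assumes b: "\<And>n. b n \<in> M" "\<And>n. norm (b n) \<le> 1" and lim: "(\<lambda>n. \<Lambda> (b n)) \<longlonglongrightarrow> \<xi>"
  shows "\<exists>a\<in>M. \<Lambda> a = \<xi>"
proof -
  obtain F T where F: "F \<noteq> bot" "F \<le> sequentially" and T: "T \<in> bounded_ops"
    and TF: "\<And>x y. ((\<lambda>n. cinner (blinfun_apply (b n) x) y) \<longlongrightarrow> cinner (blinfun_apply T x) y) F"
    using exists_weak_cluster_operator[of b, OF M(9)[OF b(1)] b(2)] by blast
  have "T \<in> commutant (commutant M)"
  proof (rule commutantI[OF T])
    fix c v assume c: "c \<in> commutant M"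
    then have cb: "c \<in> bounded_ops"
      by (rule commutant_bounded_ops)
    show "blinfun_apply T (blinfun_apply c v) = blinfun_apply c (blinfun_apply T v)"
    proof (rule cinner_left_eqI, rule tendsto_unique[OF F(1) TF])
      fix y
      have "cinner (blinfun_apply (b n) (blinfun_apply c v)) y =
          cinner (blinfun_apply (b n) v) (blinfun_apply (hadjoint c) y)" for n
        using commutantD[OF c b(1)] cb by (simp add: cinner_hadjoint)
      then show "((\<lambda>n. cinner (blinfun_apply (b n) (blinfun_apply c v)) y) \<longlongrightarrow>
          cinner (blinfun_apply c (blinfun_apply T v)) y) F"
        using TF[of v "blinfun_apply (hadjoint c) y"] cb by (simp add: cinner_hadjoint)
    qed
  qed
  then have TM: "T \<in> M"
    by (simp add: bicommutant_M)
  have inner: "cinner (\<Lambda> T) (\<Lambda> y) = cinner \<xi> (\<Lambda> y)" if y: "y \<in> M" for y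
  proof (rule tendsto_unique[OF F(1)])
    let ?d = "\<lambda>n. hadjoint y o\<^sub>L b n"
    have yb: "y \<in> bounded_ops"
      using y by (rule M(9))
    have d: "?d n \<in> M" for n
      by (intro M(7,8) b y)
    have dT: "hadjoint y o\<^sub>L T \<in> M"
      by (intro M(7,8) TM y)
    have "((\<lambda>n. \<tau> (?d n)) \<longlongrightarrow> \<tau> (hadjoint y o\<^sub>L T)) F"
    proof (rule topological_tendstoI)
      fix W :: "complex set" assume W: "open W" "\<tau> (hadjoint y o\<^sub>L T) \<in> W"
      let ?X = "subtopology ultraweak_topology M"
      have "openin ?X {x \<in> topspace ?X. \<tau> x \<in> W}"
        using normal W(1) unfolding normal_on_def by (intro openin_continuous_map_preimage) auto
      then obtain U where U: "openin ultraweak_topology U"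
          "{x \<in> topspace ?X. \<tau> x \<in> W} = U \<inter> M"
        unfolding openin_subtopology by blast
      have "topspace ?X = M"
      proof -
        \<comment> \<open>Zero sequences with \<open>U = UNIV\<close> make the whole type a subbasic
          set, so the carrier of the topology is everything.\<close>
        have "UNIV \<in> {{T. (\<Sum>n. cinner (blinfun_apply T (\<xi> n)) (\<eta> n)) \<in> U} | (\<xi> :: nat \<Rightarrow> 'k) (\<eta> :: nat \<Rightarrow> 'k) U.
            summable (\<lambda>n. (norm (\<xi> n))\<^sup>2) \<and> summable (\<lambda>n. (norm (\<eta> n))\<^sup>2) \<and> open U}"
          by (intro CollectI exI[of _ "\<lambda>_. 0"] exI[of _ UNIV]) auto
        then show ?thesis
          unfolding ultraweak_topology_def by auto
      qed
      with U(2) have UM: "x \<in> U \<longleftrightarrow> \<tau> x \<in> W" if "x \<in> M" for x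
        using that by auto
      have "eventually (\<lambda>n. ?d n \<in> U) F"
      proof (rule eventually_ultraweak_nbhd[OF _ F(1) _ U(1)])
        show "hadjoint y o\<^sub>L T \<in> U"
          using UM dT W by blast
        show "norm (?d n) \<le> norm y" for n
          using norm_blinfun_compose[of "hadjoint y" "b n"] yb
            mult_left_mono[OF b(2)[of n], of "norm y"] by simp
        show "((\<lambda>n. cinner (blinfun_apply (?d n) u) v) \<longlongrightarrow> cinner (blinfun_apply (hadjoint y o\<^sub>L T) u) v) F" for u v
          using TF[of u "blinfun_apply y v"] yb by (simp add: cinner_hadjoint_left)
      qed
      then show "eventually (\<lambda>n. \<tau> (?d n) \<in> W) F"
        by (rule eventually_mono) (use UM d in blast)
    qed
    then show "((\<lambda>n. cinner (\<Lambda> (b n)) (\<Lambda> y)) \<longlongrightarrow> cinner (\<Lambda> T) (\<Lambda> y)) F"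
      using b y TM by (simp add: Lambda_inner)
    have "((\<lambda>n. \<Lambda> (b n)) \<longlongrightarrow> \<xi>) F"
      using lim F(2) by (rule tendsto_mono[rotated])
    then show "((\<lambda>n. cinner (\<Lambda> (b n)) (\<Lambda> y)) \<longlongrightarrow> cinner \<xi> (\<Lambda> y)) F"
      by (intro tendsto_intros)
  qed
  have "\<Lambda> T = \<xi>"
  proof (rule cinner_left_eqI)
    fix w
    have "closure (\<Lambda> ` M) \<subseteq> {w. cinner (\<Lambda> T) w = cinner \<xi> w}"
      using inner by (intro closure_minimal closed_Collect_eq continuous_intros) auto
    then show "cinner (\<Lambda> T) w = cinner \<xi> w"
      by (auto simp: Lambda_dense)
  qed
  with TM show ?thesis by blast
qed

lemma inj_on_left_mult: "inj_on L M"
proof (rule inj_onI)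
  fix x y assume xy: "x \<in> M" "y \<in> M" "L x = L y"
  then have "\<Lambda> x = \<Lambda> y"
    by (metis left_mult_Omega)
  then have "\<Lambda> (x - y) = 0"
    using xy by (simp add: Lambda_diff)
  then show "x = y"
    using Lambda_eq_0D[OF M(4)[OF xy(1,2)]] by simp
qed

text \<open>Injectivity of \<open>L\<close> lets \<open>inv_into\<close> undo it, but only on the
  image of \<open>M\<close>; this is why the bicommutants have to be located there.\<close>

lemma tau_norm_L2_trace:
  assumes "T \<in> L ` M"
  shows "tau_norm (L2_trace M \<tau> \<Lambda>) T = norm (blinfun_apply T \<Omega>)"
proof -
  obtain x where x: "x \<in> M" "T = L x"
    using assms by blast
  have xx: "hadjoint x o\<^sub>L x \<in> M"
    by (intro M(7,8) x)
  have "hadjoint T o\<^sub>L T = L (hadjoint x o\<^sub>L x)"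
    using x M(8) by (simp add: left_mult_compose left_mult_hadjoint)
  then have "L2_trace M \<tau> \<Lambda> (hadjoint T o\<^sub>L T) = \<tau> (hadjoint x o\<^sub>L x)"
    using xx inj_on_left_mult by (simp add: L2_trace_def inv_into_f_f)
  then show ?thesis
    using x power2_norm_Lambda[OF x(1), symmetric] by (simp add: tau_norm_def left_mult_Omega)
qed

text \<open>The relations are algebraic and \<open>L\<close> is contractive, so a transform formed
  in the norm-closed algebra \<open>M\<close> can be pushed forward. Its image then comes with a
  preimage \<open>w\<close> in the unit ball of \<open>M\<close>.\<close>

lemma is_transform_left_mult:
  assumes "is_transform y B w" and y: "y \<in> M" and B: "B \<in> M"
  shows "w \<in> M" "is_transform (L y) (L B) (L w)"
proof -
  have *: "norm B \<le> 1" "norm w \<le> 1" "w = 2 *\<^sub>R (B o\<^sub>L y)"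
      "B o\<^sub>L (id_blinfun + (y o\<^sub>L hadjoint y)) = id_blinfun"
    using assms by (auto simp: is_transform_def)
  show w: "w \<in> M"
    unfolding * by (intro M(6,7) y B)
  have "L B o\<^sub>L (id_blinfun + (L y o\<^sub>L hadjoint (L y))) = L (B o\<^sub>L (id_blinfun + (y o\<^sub>L hadjoint y)))"
    using y B M(3,7,8) by (simp add: left_mult_compose left_mult_add left_mult_id left_mult_hadjoint)
  also have "\<dots> = id_blinfun"
    by (simp add: * left_mult_id)
  finally have "L B o\<^sub>L (id_blinfun + (L y o\<^sub>L hadjoint (L y))) = id_blinfun" .
  moreover have "L w = 2 *\<^sub>R (L B o\<^sub>L L y)"
    using y B M(7) by (simp add: * scaleR_blinfun_scaleC left_mult_scaleC left_mult_compose)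
  moreover have "norm (L B) \<le> 1" "norm (L w) \<le> 1"
    using norm_left_mult[OF B] norm_left_mult[OF w] * by auto
  ultimately show "is_transform (L y) (L B) (L w)"
    by (simp add: is_transform_def)
qed

lemma bicommutant_subset_left_mult:
  assumes A: "star_subalgebra A" and one: "id_blinfun \<in> A" and sub: "A \<subseteq> L ` M"
  shows "commutant (commutant A) \<subseteq> L ` M"
proof
  fix T0 assume T0: "T0 \<in> commutant (commutant A)"
  \<comment> \<open>Adding 1 makes \<open>T\<close> a strict contraction and covers
    \<open>T0 = 0\<close>.\<close>
  define r where "r = 1 + norm T0"
  define T where "T = (1 / r) *\<^sub>R T0"
  have r: "r > 0" "norm T0 < r"
    by (auto simp: r_def add_pos_nonneg)
  have AN: "commutant (commutant A) \<subseteq> N"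
    by (intro commutant_antimono sub)
  have T: "T \<in> commutant (commutant A)"
    unfolding T_def by (intro star_subalgebraD(6)[OF star_subalgebra_bicommutant[OF A]] T0)
  have "norm T < 1"
    using r by (simp add: T_def divide_simps)
  have "\<exists>w. w \<in> M \<and> norm w \<le> 1 \<and> norm (\<Lambda> w - blinfun_apply T \<Omega>) < inverse (real (Suc n))" for n
  proof -
    have "inverse (real (Suc n)) > 0"
      by simp
    from bicommutant_transform_approximation[OF A one norm_hadjoint_Omega T \<open>norm T < 1\<close> this] AN
    obtain y where y: "y \<in> A" "\<And>B w. is_transform y B w \<Longrightarrow>
        norm (blinfun_apply w \<Omega> - blinfun_apply T \<Omega>) < inverse (real (Suc n))"
      by blast
    obtain a where a: "a \<in> M" "y = L a"
      using y sub by blast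
    obtain B w where B: "B \<in> M" "is_transform a B w"
      using exists_transform[OF star_subalgebra_M id_in_M a(1)] unfolding closure_closed[OF closed_M]
      by blast
    note w = is_transform_left_mult[OF B(2) a(1) B(1)]
    have "norm (\<Lambda> w - blinfun_apply T \<Omega>) < inverse (real (Suc n))"
      using y(2)[of "L B" "L w"] w a by (simp add: left_mult_Omega)
    moreover have "norm w \<le> 1"
      using B unfolding is_transform_def by blast
    ultimately show ?thesis
      using w by blast
  qed
  then obtain b where b: "\<And>n. b n \<in> M" "\<And>n. norm (b n) \<le> 1"
      "\<And>n. norm (\<Lambda> (b n) - blinfun_apply T \<Omega>) < inverse (real (Suc n))"
    using choice[of "\<lambda>n w. w \<in> M \<and> norm w \<le> 1 \<and> norm (\<Lambda> w - blinfun_apply T \<Omega>) < inverse (real (Suc n))"]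
    by blast
  have "(\<lambda>n. \<Lambda> (b n) - blinfun_apply T \<Omega>) \<longlonglongrightarrow> 0"
    by (rule Lim_null_comparison[OF _ LIMSEQ_inverse_real_of_nat])
      (auto intro!: always_eventually less_imp_le b simp del: of_nat_Suc)
  then have "(\<lambda>n. \<Lambda> (b n)) \<longlonglongrightarrow> blinfun_apply T \<Omega>"
    by (rule LIM_zero_cancel)
  then obtain a where a: "a \<in> M" "\<Lambda> a = blinfun_apply T \<Omega>"
    using bounded_Lambda_limit[of b, OF b(1,2)] by blast
  \<comment> \<open>Both operators lie in \<open>N\<close> and agree on the separating vector
    \<open>\<Omega>\<close>.\<close>
  have "T = L a"
    using T AN a by (intro N_eqI left_mult_in_N) (auto simp: left_mult_Omega)
  have "T0 = r *\<^sub>R T"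
    using r by (simp add: T_def)
  also have "\<dots> \<in> L ` M"
    using star_subalgebraD(6)[OF star_subalgebra_left_mult, of T r] a \<open>T = L a\<close> by simp
  finally show "T0 \<in> L ` M" .
qed

lemma unit_ball_bicommutant_density:
  assumes A: "star_subalgebra A" and one: "id_blinfun \<in> A" and sub: "A \<subseteq> L ` M"
  shows "(\<lambda>x. blinfun_apply x \<Omega>) ` unit_ball (commutant (commutant A)) \<subseteq>
    closure ((\<lambda>x. blinfun_apply x \<Omega>) ` unit_ball A)"
proof -
  let ?C = "closure ((\<lambda>x. blinfun_apply x \<Omega>) ` unit_ball A)"
  have AN: "commutant (commutant A) \<subseteq> N"
    by (intro commutant_antimono sub)
  \<comment> \<open>Transforms lie in the norm closure of \<open>A\<close> only. Dividing the
    approximants by \<open>max 1 (norm (u n))\<close> puts them in the unit ball of \<open>A\<close>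
    and leaves the limit \<open>w\<close> unchanged.\<close>
  have approx: "blinfun_apply w \<Omega> \<in> ?C" if w: "w \<in> closure A" "norm w \<le> 1" for w
  proof -
    obtain u where u: "\<And>n. u n \<in> A" "u \<longlonglongrightarrow> w"
      using w unfolding closure_sequential by blast
    define v where "v n = (1 / max 1 (norm (u n))) *\<^sub>R u n" for n
    have "v n \<in> unit_ball A" for n
      unfolding unit_ball_def v_def using star_subalgebraD(6)[OF A u(1)] by (auto simp: divide_simps)
    moreover have "(\<lambda>n. blinfun_apply (v n) \<Omega>) \<longlonglongrightarrow> blinfun_apply ((1 / max 1 (norm w)) *\<^sub>R w) \<Omega>"
      unfolding v_def by (intro tendsto_intros u) auto
    moreover have "(1 / max 1 (norm w)) *\<^sub>R w = w"
      using w by (simp add: max_def)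
    ultimately show ?thesis
      unfolding closure_sequential by (intro exI[of _ "\<lambda>n. blinfun_apply (v n) \<Omega>"]) auto
  qed
  have strict: "blinfun_apply T \<Omega> \<in> ?C" if T: "T \<in> commutant (commutant A)" "norm T < 1" for T
  proof -
    have "\<exists>c\<in>?C. dist c (blinfun_apply T \<Omega>) < e" if e: "e > 0" for e
    proof -
      from bicommutant_transform_approximation[OF A one norm_hadjoint_Omega T e] AN
      obtain y where y: "y \<in> A" "\<And>B w. is_transform y B w \<Longrightarrow>
          norm (blinfun_apply w \<Omega> - blinfun_apply T \<Omega>) < e"
        by blast
      obtain B w where w: "w \<in> closure A" "is_transform y B w"
        using exists_transform[OF A one y(1)] by blast
      then have "norm w \<le> 1"
        unfolding is_transform_def by blast
      then have "blinfun_apply w \<Omega> \<in> ?C"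
        using w by (intro approx)
      with y(2)[OF w(2)] show ?thesis
        unfolding dist_norm by blast
    qed
    then have "blinfun_apply T \<Omega> \<in> closure ?C"
      unfolding closure_approachable[of _ ?C] by blast
    then show ?thesis by simp
  qed
  show ?thesis
  proof (intro subsetI, elim imageE)
    fix u T assume u: "u = blinfun_apply T \<Omega>" and "T \<in> unit_ball (commutant (commutant A))"
    then have T: "T \<in> commutant (commutant A)" "norm T \<le> 1"
      by (auto simp: unit_ball_def)
    \<comment> \<open>Scalars below 1 tending to 1, starting at 0, which reduce the closed ball to
      strict contractions.\<close>
    define c where "c n = 1 - inverse (real (Suc n))" for n
    have c: "0 \<le> c n" "c n < 1" for n
      by (auto simp: c_def divide_simps)
    have "blinfun_apply (c n *\<^sub>R T) \<Omega> \<in> ?C" for n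
    proof (rule strict)
      show "c n *\<^sub>R T \<in> commutant (commutant A)"
        by (intro star_subalgebraD(6)[OF star_subalgebra_bicommutant[OF A]] T)
      have "c n * norm T \<le> c n * 1"
        using c T by (intro mult_left_mono)
      then show "norm (c n *\<^sub>R T) < 1"
        using c[of n] by simp
    qed
    moreover have "(\<lambda>n. blinfun_apply (c n *\<^sub>R T) \<Omega>) \<longlonglongrightarrow> blinfun_apply ((1 - 0) *\<^sub>R T) \<Omega>"
      unfolding c_def by (intro tendsto_intros LIMSEQ_inverse_real_of_nat)
    ultimately have "blinfun_apply ((1 - 0) *\<^sub>R T) \<Omega> \<in> ?C"
      by (rule closed_sequentially[OF closed_closure])
    then show "u \<in> ?C"
      by (simp add: u)
  qed
qed

end

section \<open>Hausdorff distances and closures\<close>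

lemma infdist_closure: "infdist x (closure A) = infdist x A"
proof (cases "A = {}")
  case False
  show ?thesis
  proof (rule antisym)
    show "infdist x (closure A) \<le> infdist x A"
      using False closure_subset by (intro infdist_mono)
    have "infdist x A \<le> dist x y" if "y \<in> closure A" for y
      using infdist_triangle[of x A y] that False in_closure_iff_infdist_zero[of A y] by simp
    then show "infdist x A \<le> infdist x (closure A)"
      using False by (subst infdist_notempty[of "closure A"]) (auto intro!: cINF_greatest)
  qed
qed simp

text \<open>The sublevel set of \<open>f\<close> at its supremum over \<open>A\<close> is closed, so
  it contains the closure of \<open>A\<close>; this also bounds \<open>f\<close> there, as the real
  \<open>SUP\<close> requires.\<close>

lemma SUP_closure_continuous:
  fixes f :: "'a::topological_space \<Rightarrow> real"
  assumes "A \<noteq> {}" "continuous_on UNIV f" "bdd_above (f ` A)"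
  shows "(SUP x\<in>closure A. f x) = (SUP x\<in>A. f x)"
proof (rule antisym)
  have "A \<subseteq> {x. f x \<le> (SUP x\<in>A. f x)}"
    using assms by (auto intro!: cSUP_upper)
  then have cl: "closure A \<subseteq> {x. f x \<le> (SUP x\<in>A. f x)}"
    using assms by (intro closure_minimal closed_Collect_le continuous_intros)
  then show "(SUP x\<in>closure A. f x) \<le> (SUP x\<in>A. f x)"
    using assms by (intro cSUP_least) auto
  have "bdd_above (f ` closure A)"
    using cl by (intro bdd_aboveI[of _ "SUP x\<in>A. f x"]) auto
  then show "(SUP x\<in>A. f x) \<le> (SUP x\<in>closure A. f x)"
    using assms closure_subset by (intro cSUP_subset_mono) auto
qed

lemma SUP_infdist_closure:
  fixes A B :: "'a::metric_space set"
  assumes "A \<noteq> {}" "B \<noteq> {}" "bounded A"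
  shows "(SUP x\<in>closure A. infdist x (closure B)) = (SUP x\<in>A. infdist x B)"
  unfolding infdist_closure
proof (rule SUP_closure_continuous)
  obtain b where "b \<in> B"
    using assms by blast
  obtain e where e: "\<And>x. x \<in> A \<Longrightarrow> dist b x \<le> e"
    using assms(3) unfolding bounded_any_center[of A b] by blast
  show "bdd_above ((\<lambda>x. infdist x B) ` A)"
    using order_trans[OF infdist_le[OF \<open>b \<in> B\<close>] e[unfolded dist_commute[of b]]]
    by (intro bdd_aboveI[of _ e]) auto
qed (use assms in \<open>auto intro!: continuous_intros\<close>)

context tracial_L2
begin

text \<open>The zero operator keeps the unit balls nonempty and evaluation at
  \<open>\<Omega>\<close> keeps the orbits bounded, so each real \<open>SUP\<close> and
  \<open>INF\<close> is a genuine one. Closures are taken so that algebras with equal orbit closures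
  give identical right-hand sides.\<close>

lemma MT_dist_eq_infdist:
  assumes P: "P \<subseteq> L ` M" "0 \<in> P" and Q: "Q \<subseteq> L ` M" "0 \<in> Q"
  defines "X \<equiv> (\<lambda>x. blinfun_apply x \<Omega>) ` unit_ball P"
    and "Y \<equiv> (\<lambda>x. blinfun_apply x \<Omega>) ` unit_ball Q"
  shows "MT_dist (L2_trace M \<tau> \<Lambda>) P Q =
    max (SUP x\<in>closure X. infdist x (closure Y)) (SUP y\<in>closure Y. infdist y (closure X))"
proof -
  have ne: "X \<noteq> {}" "Y \<noteq> {}"
    using P Q by (auto simp: X_def Y_def unit_ball_def)
  have bd: "bounded ((\<lambda>x. blinfun_apply x \<Omega>) ` unit_ball S)" for S
  proof (rule boundedI)
    fix v assume "v \<in> (\<lambda>x. blinfun_apply x \<Omega>) ` unit_ball S"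
    then obtain x where x: "norm x \<le> 1" "v = blinfun_apply x \<Omega>"
      by (auto simp: unit_ball_def)
    then show "norm v \<le> norm \<Omega>"
      using norm_blinfun[of x \<Omega>] mult_right_mono[OF x(1), of "norm \<Omega>"] by simp
  qed
  have d: "tau_norm (L2_trace M \<tau> \<Lambda>) (x - y) = dist (blinfun_apply x \<Omega>) (blinfun_apply y \<Omega>)"
    if "x \<in> unit_ball P" "y \<in> unit_ball Q" for x y
  proof -
    have "x - y \<in> L ` M"
      using that P Q by (intro star_subalgebraD(4)[OF star_subalgebra_left_mult]) (auto simp: unit_ball_def)
    then show ?thesis
      by (simp add: tau_norm_L2_trace dist_norm blinfun.diff_left)
  qed
  have "(INF y\<in>unit_ball Q. tau_norm (L2_trace M \<tau> \<Lambda>) (x - y)) = infdist (blinfun_apply x \<Omega>) Y"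
    if "x \<in> unit_ball P" for x
    using ne that by (simp add: infdist_notempty Y_def image_image d)
  moreover have "(INF x\<in>unit_ball P. tau_norm (L2_trace M \<tau> \<Lambda>) (x - y)) = infdist (blinfun_apply y \<Omega>) X"
    if "y \<in> unit_ball Q" for y
    using ne that by (simp add: infdist_notempty X_def image_image d dist_commute)
  ultimately have "MT_dist (L2_trace M \<tau> \<Lambda>) P Q = max (SUP x\<in>X. infdist x Y) (SUP y\<in>Y. infdist y X)"
    unfolding MT_dist_def by (simp add: X_def Y_def image_image)
  then show ?thesis
    using SUP_infdist_closure[OF ne] SUP_infdist_closure[OF ne(2,1)] bd by (simp add: X_def Y_def)
qed

text \<open>Collects the side conditions of \<open>MT_dist_eq_infdist\<close> and the equations that
  rewrite every orbit closure to that of \<open>A\<close>.\<close>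

lemma unit_ball_orbit_closures:
  assumes A: "star_subalgebra A" and one: "id_blinfun \<in> A" and sub: "A \<subseteq> L ` M"
  defines "orbit \<equiv> \<lambda>S. closure ((\<lambda>x. blinfun_apply x \<Omega>) ` unit_ball S)"
  shows "sot_closure A \<subseteq> L ` M" "commutant (commutant A) \<subseteq> L ` M"
    and "0 \<in> A" "0 \<in> sot_closure A" "0 \<in> commutant (commutant A)"
    and "orbit (sot_closure A) = orbit A" "orbit (commutant (commutant A)) = orbit A"
proof -
  note A' = star_subalgebraD[OF A]
  have 1: "A \<subseteq> sot_closure A"
    by (intro closure_of_subset) (simp add: strong_operator_topology_topspace)
  have 2: "sot_closure A \<subseteq> commutant (commutant A)"
    using A'(1) by (rule sot_closure_subset_bicommutant)
  show 3: "commutant (commutant A) \<subseteq> L ` M"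
    using A one sub by (rule bicommutant_subset_left_mult)
  show "sot_closure A \<subseteq> L ` M"
    using 2 3 by blast
  show 0: "0 \<in> A"
    by (rule A'(2))
  show "0 \<in> sot_closure A" "0 \<in> commutant (commutant A)"
    using 0 1 2 by auto
  have mono: "orbit S \<subseteq> orbit T" if "S \<subseteq> T" for S T
    unfolding orbit_def unit_ball_def using that by (intro closure_mono image_mono) auto
  have "orbit (commutant (commutant A)) \<subseteq> orbit A"
    unfolding orbit_def using unit_ball_bicommutant_density[OF A one sub] by (intro closure_minimal) auto
  with mono[OF 1] mono[OF 2]
  show "orbit (sot_closure A) = orbit A" "orbit (commutant (commutant A)) = orbit A"
    by auto
qed

end

theorem proposition5p5:
  fixes M :: "('k::complex_hilbert \<Rightarrow>\<^sub>L 'k) set"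
    and \<tau> :: "('k \<Rightarrow>\<^sub>L 'k) \<Rightarrow> complex"
    and \<Lambda> :: "('k \<Rightarrow>\<^sub>L 'k) \<Rightarrow> 'h::complex_hilbert"
    and P Q :: "('h \<Rightarrow>\<^sub>L 'h) set"
  assumes "von_neumann_algebra M"
    and "state_on M \<tau>" and "faithful_on M \<tau>" and "normal_on M \<tau>" and "tracial_on M \<tau>"
    and "is_L2 M \<tau> \<Lambda>"
    and "star_subalgebra P" and "P \<subseteq> left_mult M \<Lambda> ` M" and "id_blinfun \<in> P"
    and "star_subalgebra Q" and "Q \<subseteq> left_mult M \<Lambda> ` M" and "id_blinfun \<in> Q"
  shows "MT_dist (L2_trace M \<tau> \<Lambda>) P Q = MT_dist (L2_trace M \<tau> \<Lambda>) P (sot_closure Q) \<and>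
    MT_dist (L2_trace M \<tau> \<Lambda>) P (sot_closure Q) =
      MT_dist (L2_trace M \<tau> \<Lambda>) (sot_closure P) (sot_closure Q) \<and>
    MT_dist (L2_trace M \<tau> \<Lambda>) (sot_closure P) (sot_closure Q) =
      MT_dist (L2_trace M \<tau> \<Lambda>) (commutant (commutant P)) (commutant (commutant Q))"
proof -
  interpret tracial_L2 M \<tau> \<Lambda>
    using assms(1-6) by unfold_locales
  note P = unit_ball_orbit_closures[OF assms(7,9,8)] and Q = unit_ball_orbit_closures[OF assms(10,12,11)]
  show ?thesis
    \<comment> \<open>All four distances become the same expression in the orbit closures of
      \<open>P\<close> and \<open>Q\<close>.\<close>
    by (simp add: MT_dist_eq_infdist assms(8,11) P Q)
qed

end
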